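(* Let $(X,f)$ be an irreducible Smale space. Then $(X,f)$ satisfies the Garden of Eden theorem; that is, every surjective endomorphism of $(X,f)$ is pre-injective (Moore property) and every pre-injective endomorphism of $(X,f)$ is surjective (Myhill property).
   Context: A dynamical system is a pair $(X,f)$ where $X$ is a compact metrizable space and $f\colon X\to X$ is a homeomorphism. Fix any compatible metric $d$ on $X$ (by compactness none of the notions below depends on the choice of $d$). $f$ is expansive if there is $\eta>0$ such that for all distinct $x,y\in X$ there is $n\in\mathbb{Z}$ with $d(f^n(x),f^n(y))>\eta$. For $\delta>0$, a $\delta$-pseudo-orbit is a sequence $(u_n)_{n\in\mathbb{Z}}$ in $X$ with $d(u_{n+1},f(u_n))\le\delta$ for all $n\in\mathbb{Z}$. It is $\varepsilon$-traced by the orbit of $x\in X$ if $d(u_n,f^n(x))\le\varepsilon$ for all $n\in\mathbb{Z}$. $(X,f)$ has the pseudo-orbit tracing property if for every $\varepsilon>0$ there is $\delta>0$ such that every $\delta$-pseudo-orbit in $X$ is $\varepsilon$-traced by the orbit of some point of $X$. A Smale space is a dynamical system $(X,f)$ such that $f$ is expansive and has the pseudo-orbit tracing property. $(X,f)$ is irreducible if for all non-empty open subsets $U,V\subset X$ there is an integer $n\ge 1$ with $U\cap f^n(V)\neq\varnothing$. An endomorphism of $(X,f)$ is a continuous map $\tau\colon X\to X$ with $\tau\circ f=f\circ\tau$. Two points $x,y\in X$ are homoclinic if $d(f^n(x),f^n(y))\to 0$ as $|n|\to\infty$; this is an equivalence relation. An endomorphism is pre-injective if its restriction to every homoclinicity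 class is injective. *)

theory Defs
  imports "HOL-Analysis.Analysis"
begin

text \<open>
  The space is a compact subset \<open>X\<close> of a metric space, carrying the subspace topology, and \<open>dist\<close>
  is the chosen compatible metric. Maps are functions on the ambient type of which only the
  values on \<open>X\<close> matter.
\<close>

definition dynamical_system :: "'a::metric_space set \<Rightarrow> ('a \<Rightarrow> 'a) \<Rightarrow> bool" where
  "dynamical_system X f \<longleftrightarrow> compact X \<and> (\<exists>g. homeomorphism X X f g)"

text \<open>
  \<open>int_iter X f n\<close> is \<open>f\<^sup>n\<close> on \<open>X\<close> for integer \<open>n\<close>. The inverse is taken relative to \<open>X\<close>, since
  \<open>f\<close> need not be injective outside \<open>X\<close>.
\<close>

definition int_iter :: "'a set \<Rightarrow> ('a \<Rightarrow> 'a) \<Rightarrow> int \<Rightarrow> 'a \<Rightarrow> 'a" where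
  "int_iter X f n = (if 0 \<le> n then f ^^ nat n else inv_into X f ^^ nat (- n))"

definition expansive :: "'a::metric_space set \<Rightarrow> ('a \<Rightarrow> 'a) \<Rightarrow> bool" where
  "expansive X f \<longleftrightarrow>
     (\<exists>\<eta>>0. \<forall>x\<in>X. \<forall>y\<in>X. x \<noteq> y \<longrightarrow> (\<exists>n::int. dist (int_iter X f n x) (int_iter X f n y) > \<eta>))"

definition pseudo_orbit :: "'a::metric_space set \<Rightarrow> ('a \<Rightarrow> 'a) \<Rightarrow> real \<Rightarrow> (int \<Rightarrow> 'a) \<Rightarrow> bool" where
  "pseudo_orbit X f \<delta> u \<longleftrightarrow> (\<forall>n. u n \<in> X) \<and> (\<forall>n. dist (u (n + 1)) (f (u n)) \<le> \<delta>)"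

definition traced_by ::
  "'a::metric_space set \<Rightarrow> ('a \<Rightarrow> 'a) \<Rightarrow> real \<Rightarrow> (int \<Rightarrow> 'a) \<Rightarrow> 'a \<Rightarrow> bool" where
  "traced_by X f \<epsilon> u x \<longleftrightarrow> (\<forall>n. dist (u n) (int_iter X f n x) \<le> \<epsilon>)"

definition pseudo_orbit_tracing_property :: "'a::metric_space set \<Rightarrow> ('a \<Rightarrow> 'a) \<Rightarrow> bool" where
  "pseudo_orbit_tracing_property X f \<longleftrightarrow>
     (\<forall>\<epsilon>>0. \<exists>\<delta>>0. \<forall>u. pseudo_orbit X f \<delta> u \<longrightarrow> (\<exists>x\<in>X. traced_by X f \<epsilon> u x))"

definition Smale_space :: "'a::metric_space set \<Rightarrow> ('a \<Rightarrow> 'a) \<Rightarrow> bool" where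
  "Smale_space X f \<longleftrightarrow>
     dynamical_system X f \<and> expansive X f \<and> pseudo_orbit_tracing_property X f"

definition irreducible_system :: "'a::metric_space set \<Rightarrow> ('a \<Rightarrow> 'a) \<Rightarrow> bool" where
  "irreducible_system X f \<longleftrightarrow>
     (\<forall>U V. openin (top_of_set X) U \<longrightarrow> openin (top_of_set X) V \<longrightarrow> U \<noteq> {} \<longrightarrow> V \<noteq> {} \<longrightarrow>
        (\<exists>n\<ge>1. U \<inter> (f ^^ n) ` V \<noteq> {}))"

definition system_endomorphism ::
  "'a::metric_space set \<Rightarrow> ('a \<Rightarrow> 'a) \<Rightarrow> ('a \<Rightarrow> 'a) \<Rightarrow> bool" where
  "system_endomorphism X f \<tau> \<longleftrightarrow>
     continuous_on X \<tau> \<and> \<tau> ` X \<subseteq> X \<and> (\<forall>x\<in>X. \<tau> (f x) = f (\<tau> x))"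

text \<open>The filter \<open>filtercomap abs at_top\<close> on the integers expresses \<open>\<bar>n\<bar> \<rightarrow> \<infinity>\<close>.\<close>

definition homoclinic :: "'a::metric_space set \<Rightarrow> ('a \<Rightarrow> 'a) \<Rightarrow> 'a \<Rightarrow> 'a \<Rightarrow> bool" where
  "homoclinic X f x y \<longleftrightarrow>
     ((\<lambda>n::int. dist (int_iter X f n x) (int_iter X f n y)) \<longlongrightarrow> 0) (filtercomap abs at_top)"

definition pre_injective :: "'a::metric_space set \<Rightarrow> ('a \<Rightarrow> 'a) \<Rightarrow> ('a \<Rightarrow> 'a) \<Rightarrow> bool" where
  "pre_injective X f \<tau> \<longleftrightarrow> (\<forall>x\<in>X. inj_on \<tau> {y \<in> X. homoclinic X f x y})"

definition Moore_property :: "'a::metric_space set \<Rightarrow> ('a \<Rightarrow> 'a) \<Rightarrow> bool" where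
  "Moore_property X f \<longleftrightarrow>
     (\<forall>\<tau>. system_endomorphism X f \<tau> \<and> \<tau> ` X = X \<longrightarrow> pre_injective X f \<tau>)"

definition Myhill_property :: "'a::metric_space set \<Rightarrow> ('a \<Rightarrow> 'a) \<Rightarrow> bool" where
  "Myhill_property X f \<longleftrightarrow>
     (\<forall>\<tau>. system_endomorphism X f \<tau> \<and> pre_injective X f \<tau> \<longrightarrow> \<tau> ` X = X)"

end

theory Submission
  imports Defs
begin

text \<open>
  Both implications come from counting orbit segments that are separated up to a fixed scale.
  Suppose that a set of orbits avoids a neighbourhood of a point \<open>x\<close> at all multiples of some \<open>h\<close>.
  By irreducibility and tracing a visit to \<open>x\<close> can be inserted, independently, into each of \<open>n\<close>
  consecutive time blocks of a fixed length. Hence the avoiding orbits are fewer than all orbits by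
  an exponential factor \<open>(1 + 1 / K)\<^sup>n\<close>.

  If \<open>\<tau>\<close> is surjective but identifies two homoclinic points \<open>x\<close> and \<open>y\<close>, then substituting \<open>y\<close> for
  \<open>x\<close> shows that the orbits avoiding \<open>x\<close> already have all of \<open>X\<close> as image, and \<open>X\<close> would have too
  few orbits. If \<open>\<tau>\<close> is not surjective, its image avoids a ball and has too few orbits; but
  orbit segments of \<open>X\<close> can be completed by common tails to homoclinic points, whose images would
  coincide for some pair.
\<close>

section \<open>Exponential growth and powers of a relation\<close>

text \<open>Bernoulli's inequality for \<open>1 + 1 / K\<close>, cleared of denominators: at
  \<open>n = C * K\<close> the ratio of the two powers already exceeds \<open>C\<close>. Both
  counting arguments end in this contradiction.\<close>

lemma pow_growth:
  fixes C K :: nat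
  assumes "K > 0" "\<And>n. Suc K ^ n \<le> C * K ^ n"
  shows False
proof -
  have "K ^ n * (K + n) \<le> Suc K ^ n * K" for n
  proof (induction n)
    case (Suc n)
    have "K ^ Suc n * (K + Suc n) \<le> Suc K * (K ^ n * (K + n))" by (simp add: algebra_simps)
    also have "\<dots> \<le> Suc K * (Suc K ^ n * K)" using Suc by (rule mult_le_mono2)
    finally show ?case by (simp only: power_Suc mult.assoc)
  qed simp
  from this[of "C * K"] have "K ^ (C * K) * (K + C * K) \<le> Suc K ^ (C * K) * K" .
  also have "\<dots> \<le> C * K ^ (C * K) * K" using assms(2) by (rule mult_le_mono1)
  finally have "K ^ (C * K) * (K + C * K) \<le> K ^ (C * K) * (C * K)" by (simp add: mult_ac)
  then show False using assms(1) by simp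
qed

lemma relpow_loop: "(x, x) \<in> R ^^ l \<Longrightarrow> (x, x) \<in> R ^^ (s * l)"
proof (induction s)
  case (Suc s)
  then show ?case using relpow_trans[of x x l R x "s * l"] by (simp add: add.commute)
qed simp

text \<open>Membership in a relation power hides the intermediate points. Pseudo-orbits need them as
  a function, together with the exact time of the visit to \<open>x\<close>.\<close>

lemma chain_through:
  assumes "(a, x) \<in> R ^^ t" "(x, b) \<in> R ^^ u"
  obtains v where "v 0 = a" "v t = x" "v (t + u) = b" "\<forall>i<t + u. (v i, v (Suc i)) \<in> R"
proof -
  obtain v1 where v1: "v1 0 = a" "v1 t = x" "\<forall>i<t. (v1 i, v1 (Suc i)) \<in> R"
    using assms(1) unfolding relpow_fun_conv by blast
  obtain v2 where v2: "v2 0 = x" "v2 u = b" "\<forall>i<u. (v2 i, v2 (Suc i)) \<in> R"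
    using assms(2) unfolding relpow_fun_conv by blast
  define v where "v i = (if i < t then v1 i else v2 (i - t))" for i
  have le: "v i = v1 i" if "i \<le> t" for i using that v1(2) v2(1) by (cases "i = t") (simp_all add: v_def)
  have "(v i, v (Suc i)) \<in> R" if "i < t + u" for i
  proof (cases "i < t")
    case True
    then show ?thesis using le v1(3) by simp
  next
    case False
    then have "v i = v2 (i - t)" "v (Suc i) = v2 (Suc (i - t))" by (simp_all add: v_def Suc_diff_le)
    then show ?thesis using v2(3) that False by simp
  qed
  then show thesis using le[of 0] le[of t] v1 v2 by (intro that[of v]) (simp_all add: v_def)
qed

section \<open>Integer iterates, irreducibility and compactness\<close>

locale irreducible_Smale =
  fixes X :: "'a::metric_space set" and f :: "'a \<Rightarrow> 'a"
  assumes Smale: "Smale_space X f" and irreducible: "irreducible_system X f"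
begin

abbreviation F :: "int \<Rightarrow> 'a \<Rightarrow> 'a" where
  "F \<equiv> int_iter X f"

lemma dyn: "dynamical_system X f"
  using Smale by (simp add: Smale_space_def)

lemma compact_X: "compact X"
  using dyn by (simp add: dynamical_system_def)

lemma bij_f: "bij_betw f X X"
  using dyn unfolding dynamical_system_def homeomorphism_def
  by (metis bij_betw_def inj_on_inverseI)

lemma f_in: "x \<in> X \<Longrightarrow> f x \<in> X"
  using bij_f by (auto dest: bij_betwE)

lemma inv_in: "x \<in> X \<Longrightarrow> inv_into X f x \<in> X"
  using bij_f by (metis bij_betw_def inv_into_into)

lemma f_inv: "x \<in> X \<Longrightarrow> f (inv_into X f x) = x"
  using bij_f by (metis bij_betw_def f_inv_into_f)

lemma inv_f: "x \<in> X \<Longrightarrow> inv_into X f (f x) = x"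
  using bij_f by (metis bij_betw_def inv_into_f_f)

lemma cont_f: "continuous_on X f"
  using dyn unfolding dynamical_system_def homeomorphism_def by blast

lemma cont_inv: "continuous_on X (inv_into X f)"
proof -
  obtain g where g: "homeomorphism X X f g"
    using dyn unfolding dynamical_system_def by blast
  have "inv_into X f x = g x" if "x \<in> X" for x
    using g that inv_f unfolding homeomorphism_def by (metis imageI)
  then show ?thesis
    using g continuous_on_cong unfolding homeomorphism_def by metis
qed

lemma funpow_in: "x \<in> X \<Longrightarrow> (f ^^ n) x \<in> X"
  by (induction n) (auto intro: f_in)

lemma inv_funpow_in: "x \<in> X \<Longrightarrow> (inv_into X f ^^ n) x \<in> X"
  by (induction n) (auto intro: inv_in)

lemma F_in [simp]: "x \<in> X \<Longrightarrow> F n x \<in> X"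
  by (simp add: int_iter_def funpow_in inv_funpow_in)

lemma F_0 [simp]: "F 0 x = x"
  by (simp add: int_iter_def)

lemma F_Suc: assumes "x \<in> X" shows "F (n + 1) x = f (F n x)"
proof (cases "n \<ge> 0")
  case True
  then have "nat (n + 1) = Suc (nat n)" by simp
  with True show ?thesis by (simp add: int_iter_def)
next
  case False
  then have *: "nat (- n) = Suc (nat (- (n + 1)))" by simp
  have "f (F n x) = (inv_into X f ^^ nat (- (n + 1))) x"
    using False * f_inv[OF inv_funpow_in[OF assms]] by (simp add: int_iter_def)
  \<comment> \<open>At \<open>n = -1\<close> the definition of \<open>int_iter\<close> passes from
    powers of the inverse to \<open>f ^^ 0\<close>.\<close>
  also have "\<dots> = F (n + 1) x"
    using False by (cases "n = -1") (auto simp: int_iter_def)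
  finally show ?thesis by simp
qed

lemma F_pred: assumes "x \<in> X" shows "F (n - 1) x = inv_into X f (F n x)"
  using F_Suc[OF assms, of "n - 1"] inv_f[of "F (n - 1) x"] assms by simp

lemma F_add: assumes "x \<in> X" shows "F (m + n) x = F m (F n x)"
proof (induction m rule: int_induct[where k = 0])
  case (step1 i)
  then show ?case using F_Suc[of "F n x" i] F_Suc[OF assms, of "i + n"] assms
    by (simp add: algebra_simps)
next
  case (step2 i)
  then show ?case using F_pred[of "F n x" i] F_pred[OF assms, of "i + n"] assms
    by (simp add: algebra_simps)
qed simp

lemma cont_F: "continuous_on X (F n)"
proof (induction n rule: int_induct[where k = 0])
  case base
  then show ?case by (simp add: continuous_on_id)
next
  case (step1 i)
  have "continuous_on X (\<lambda>x. f (F i x))"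
    by (rule continuous_on_compose2[OF cont_f step1(2)]) auto
  then show ?case by (rule continuous_on_eq) (simp add: F_Suc)
next
  case (step2 i)
  have "continuous_on X (\<lambda>x. inv_into X f (F i x))"
    by (rule continuous_on_compose2[OF cont_inv step2(2)]) auto
  then show ?case by (rule continuous_on_eq) (simp add: F_pred)
qed

lemma shadowing:
  assumes "\<epsilon> > 0"
  obtains \<delta> where "\<delta> > 0" "\<forall>u. pseudo_orbit X f \<delta> u \<longrightarrow> (\<exists>x\<in>X. traced_by X f \<epsilon> u x)"
  using Smale assms unfolding Smale_space_def pseudo_orbit_tracing_property_def by blast

text \<open>Irreducibility applied to relative balls. The image is taken of the ball around
  \<open>a\<close>, so that the orbit runs from near \<open>a\<close> to near
  \<open>b\<close>.\<close>

lemma transitive: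
  assumes "a \<in> X" "b \<in> X" "r > 0"
  obtains v n where "v \<in> X" "n \<ge> (1::nat)" "dist v a < r" "dist (F (int n) v) b < r"
proof -
  have "openin (top_of_set X) (X \<inter> ball c r)" for c by (simp add: openin_open_Int)
  moreover have "a \<in> X \<inter> ball a r" "b \<in> X \<inter> ball b r" using assms by auto
  ultimately obtain n where "n \<ge> 1" "(X \<inter> ball b r) \<inter> (f ^^ n) ` (X \<inter> ball a r) \<noteq> {}"
    using irreducible unfolding irreducible_system_def by (metis empty_iff)
  then obtain v where "v \<in> X" "dist v a < r" "dist ((f ^^ n) v) b < r" by (auto simp: dist_commute)
  then show thesis using that[of v n] \<open>n \<ge> 1\<close> by (simp add: int_iter_def)
qed

text \<open>Each iterate is uniformly continuous on the compact \<open>X\<close>, and the least of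
  finitely many moduli serves them all.\<close>

lemma equicontinuous:
  assumes "finite I" "\<epsilon> > 0"
  obtains d where "d > 0"
    "\<forall>q\<in>X. \<forall>q'\<in>X. dist q q' < d \<longrightarrow> (\<forall>i\<in>I. dist (F i q) (F i q') < \<epsilon>)"
proof -
  have "\<exists>d>0. \<forall>q\<in>X. \<forall>q'\<in>X. dist q q' < d \<longrightarrow> (\<forall>i\<in>I. dist (F i q) (F i q') < \<epsilon>)"
    using assms(1)
  proof induction
    case empty
    then show ?case by (intro exI[of _ 1]) simp
  next
    case (insert j I)
    obtain d where d: "d > 0" "\<forall>q\<in>X. \<forall>q'\<in>X. dist q q' < d \<longrightarrow> (\<forall>i\<in>I. dist (F i q) (F i q') < \<epsilon>)"
      using insert.IH by blast
    obtain d' where d': "d' > 0" "\<forall>q\<in>X. \<forall>q'\<in>X. dist q q' < d' \<longrightarrow> dist (F j q) (F j q') < \<epsilon>"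
      using compact_uniformly_continuous[OF cont_F compact_X, of j] \<open>\<epsilon> > 0\<close>
      unfolding uniformly_continuous_on_def by (metis dist_commute)
    show ?case using d d' by (intro exI[of _ "min d d'"]) simp
  qed
  then show thesis using that by blast
qed

text \<open>Total boundedness in a form suited to counting: a point takes the number of a nearby
  centre in a finite cover by balls of half the modulus of equicontinuity. Colours serve later as a
  finite alphabet and for pigeonholes.\<close>

lemma colouring:
  assumes "finite I" "\<epsilon> > 0"
  obtains col :: "'a \<Rightarrow> nat" and K where "K > 0" "col ` X \<subseteq> {..<K}"
    "\<forall>q\<in>X. \<forall>q'\<in>X. col q = col q' \<longrightarrow> (\<forall>i\<in>I. dist (F i q) (F i q') \<le> \<epsilon>)"
proof -
  obtain d where d: "d > 0"
    "\<forall>q\<in>X. \<forall>q'\<in>X. dist q q' < d \<longrightarrow> (\<forall>i\<in>I. dist (F i q) (F i q') < \<epsilon>)"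
    by (rule equicontinuous[OF assms])
  obtain k where k: "finite k" "k \<subseteq> X" "X \<subseteq> (\<Union>x\<in>k. ball x (d / 2))"
  proof (rule compactE_image[OF compact_X, of X "\<lambda>x. ball x (d / 2)"])
    show "X \<subseteq> (\<Union>x\<in>X. ball x (d / 2))" using \<open>d > 0\<close> by auto
  qed auto
  obtain num :: "'a \<Rightarrow> nat" and K where num: "num ` k = {i. i < K}" "inj_on num k"
    using finite_imp_inj_to_nat_seg[OF k(1)] by blast
  define c where "c q = (SOME x. x \<in> k \<and> dist x q < d / 2)" for q
  have c: "c q \<in> k" "dist (c q) q < d / 2" if "q \<in> X" for q
  proof -
    have "\<exists>x. x \<in> k \<and> dist x q < d / 2"
      using k(3) that by (meson UN_E mem_ball subsetD)
    then have "c q \<in> k \<and> dist (c q) q < d / 2" unfolding c_def by (rule someI_ex)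
    then show "c q \<in> k" "dist (c q) q < d / 2" by auto
  qed
  show thesis
  \<comment> \<open>\<open>Suc K\<close> keeps the number of colours positive even when
    \<open>X\<close> is empty.\<close>
  proof (rule that[of "Suc K" "\<lambda>q. num (c q)"])
    show "(\<lambda>q. num (c q)) ` X \<subseteq> {..<Suc K}"
      using c(1) num(1) by (auto intro: less_SucI)
    have "dist q q' < d" if q: "q \<in> X" "q' \<in> X" "num (c q) = num (c q')" for q q'
    proof -
      have "c q = c q'" using num(2) c(1) q by (auto dest: inj_onD)
      then show ?thesis using c(2)[OF q(1)] c(2)[OF q(2)]
        by (metis dist_commute dist_triangle_half_r)
    qed
    then show "\<forall>q\<in>X. \<forall>q'\<in>X. num (c q) = num (c q') \<longrightarrow> (\<forall>i\<in>I. dist (F i q) (F i q') \<le> \<epsilon>)"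
      using d(2) by (meson less_imp_le)
  qed simp
qed

subsection \<open>Separated and spanning sets\<close>

text \<open>Bowen's separated sets, in contrapositive form. The set of times is a parameter because
  windows with a margin at both ends occur later.\<close>

definition separated :: "int set \<Rightarrow> real \<Rightarrow> 'a set \<Rightarrow> bool" where
  "separated I \<epsilon> S \<longleftrightarrow> (\<forall>x\<in>S. \<forall>y\<in>S. (\<forall>i\<in>I. dist (F i x) (F i y) \<le> \<epsilon>) \<longrightarrow> x = y)"

definition spans :: "int set \<Rightarrow> real \<Rightarrow> 'a set \<Rightarrow> 'a set \<Rightarrow> bool" where
  "spans I \<epsilon> T A \<longleftrightarrow> (\<forall>a\<in>A. \<exists>t\<in>T. \<forall>i\<in>I. dist (F i a) (F i t) \<le> \<epsilon>)"

text \<open>Colours are distinct on a separated set, which bounds its size, so one of greatest size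
  exists; a point that it failed to span could be added to it.\<close>

lemma maximal_separated:
  assumes "finite I" "\<epsilon> > 0" "A \<subseteq> X"
  obtains T where "T \<subseteq> A" "finite T" "separated I \<epsilon> T" "spans I \<epsilon> T A"
proof -
  obtain col :: "'a \<Rightarrow> nat" and K where "K > 0" and col: "col ` X \<subseteq> {..<K}"
    "\<forall>q\<in>X. \<forall>q'\<in>X. col q = col q' \<longrightarrow> (\<forall>i\<in>I. dist (F i q) (F i q') \<le> \<epsilon>)"
    by (rule colouring[OF assms(1,2)])
  define P where "P T \<longleftrightarrow> T \<subseteq> A \<and> separated I \<epsilon> T" for T
  have fin: "finite T \<and> card T \<le> K" if "P T" for T
  proof -
    have "inj_on col T"
      using that col(2) assms(3) unfolding P_def separated_def inj_on_def by blast
    moreover have "col ` T \<subseteq> {..<K}" using col(1) that assms(3) unfolding P_def by blast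
    ultimately show ?thesis
      by (metis card_inj_on_le card_lessThan finite_lessThan inj_on_finite)
  qed
  have "P {}" by (simp add: P_def separated_def)
  then obtain T where T: "P T" "\<And>T'. P T' \<Longrightarrow> card T' \<le> card T"
    using ex_has_greatest_nat[of P "{}" card "Suc K"] fin by (metis less_Suc_eq_le)
  have "spans I \<epsilon> T A"
  proof (rule ccontr)
    assume "\<not> spans I \<epsilon> T A"
    then obtain a where a: "a \<in> A" "\<And>t. t \<in> T \<Longrightarrow> \<exists>i\<in>I. \<not> dist (F i a) (F i t) \<le> \<epsilon>"
      unfolding spans_def by blast
    have "a \<notin> T" using a(2)[of a] assms(2) by auto
    moreover have "P (insert a T)"
      using T(1) a unfolding P_def separated_def by (metis dist_commute insert_iff insert_subset)
    ultimately show False using T(2)[of "insert a T"] fin[OF T(1)] by simp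
  qed
  then show thesis using that T(1) fin unfolding P_def by blast
qed

section \<open>Expansivity and comparison of scales\<close>

text \<open>One constant is fixed by choice, so that all later scales can refer to it.\<close>

definition expansivity :: real where
  "expansivity = (SOME \<eta>. \<eta> > 0 \<and> (\<forall>x\<in>X. \<forall>y\<in>X. x \<noteq> y \<longrightarrow> (\<exists>n. dist (F n x) (F n y) > \<eta>)))"

lemma expansivity_pos: "expansivity > 0"
  and expansivity: "x \<in> X \<Longrightarrow> y \<in> X \<Longrightarrow> (\<And>n. dist (F n x) (F n y) \<le> expansivity) \<Longrightarrow> x = y"
proof -
  have "expansivity > 0 \<and>
    (\<forall>x\<in>X. \<forall>y\<in>X. x \<noteq> y \<longrightarrow> (\<exists>n. dist (F n x) (F n y) > expansivity))"
    unfolding expansivity_def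
    by (rule someI_ex) (use Smale in \<open>auto simp: Smale_space_def expansive_def\<close>)
  then show "expansivity > 0"
    and "x \<in> X \<Longrightarrow> y \<in> X \<Longrightarrow> (\<And>n. dist (F n x) (F n y) \<le> expansivity) \<Longrightarrow> x = y"
    by (auto simp: not_less[symmetric])
qed

text \<open>Counterexamples for every window would converge along a subsequence to two points that
  stay within the expansivity constant at all times. These coincide, yet they are at distance at
  least \<epsilon>.\<close>

lemma uniform_expansivity:
  assumes "\<epsilon> > 0"
  obtains m :: nat where "\<forall>x\<in>X. \<forall>y\<in>X.
    (\<forall>i. \<bar>i\<bar> \<le> int m \<longrightarrow> dist (F i x) (F i y) \<le> expansivity) \<longrightarrow> dist x y \<le> \<epsilon>"
proof -
  have "\<exists>m::nat. \<forall>x\<in>X. \<forall>y\<in>X. (\<forall>i. \<bar>i\<bar> \<le> int m \<longrightarrow> dist (F i x) (F i y) \<le> expansivity) \<longrightarrow> dist x y \<le> \<epsilon>"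
  proof (rule ccontr)
    assume "\<not> ?thesis"
    then have "\<exists>x y. x \<in> X \<and> y \<in> X \<and> (\<forall>i. \<bar>i\<bar> \<le> int m \<longrightarrow> dist (F i x) (F i y) \<le> expansivity) \<and>
        dist x y > \<epsilon>" for m
      by (meson not_le)
    then obtain a b where ab: "\<And>m. a m \<in> X" "\<And>m. b m \<in> X"
      "\<And>m i. \<bar>i\<bar> \<le> int m \<Longrightarrow> dist (F i (a m)) (F i (b m)) \<le> expansivity" "\<And>m. dist (a m) (b m) > \<epsilon>"
      by metis
    have "seq_compact (X \<times> X)"
      using compact_X by (simp add: compact_Times compact_imp_seq_compact)
    then obtain l r where l: "l \<in> X \<times> X" "strict_mono r" "((\<lambda>n. (a n, b n)) \<circ> r) \<longlonglongrightarrow> l"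
      by (rule seq_compactE[where f = "\<lambda>n. (a n, b n)"]) (simp_all add: ab)
    obtain x y where xy: "l = (x, y)" by (cases l)
    have x: "x \<in> X" "y \<in> X" using l(1) xy by auto
    have lim: "(\<lambda>n. a (r n)) \<longlonglongrightarrow> x" "(\<lambda>n. b (r n)) \<longlonglongrightarrow> y"
      using tendsto_fst[OF l(3)] tendsto_snd[OF l(3)] xy by (simp_all add: o_def)
    have limF: "(\<lambda>n. F i (a (r n))) \<longlonglongrightarrow> F i x" "(\<lambda>n. F i (b (r n))) \<longlonglongrightarrow> F i y" for i
      using cont_F[of i] x lim ab(1,2) by (auto simp: continuous_on_sequentially o_def)
    have "dist (F i x) (F i y) \<le> expansivity" for i
    proof (rule LIMSEQ_le_const2)
      show "(\<lambda>n. dist (F i (a (r n))) (F i (b (r n)))) \<longlonglongrightarrow> dist (F i x) (F i y)"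
        by (intro tendsto_dist limF)
      show "\<exists>N. \<forall>n\<ge>N. dist (F i (a (r n))) (F i (b (r n))) \<le> expansivity"
      proof (intro exI allI impI)
        fix n assume "nat \<bar>i\<bar> \<le> n"
        also have "n \<le> r n" using l(2) by (rule seq_suble)
        finally show "dist (F i (a (r n))) (F i (b (r n))) \<le> expansivity"
          by (intro ab(3)) linarith
      qed
    qed
    then have "x = y" using expansivity x by blast
    moreover have "dist x y \<ge> \<epsilon>"
      by (rule LIMSEQ_le_const[OF tendsto_dist[OF lim]]) (use ab(4) less_imp_le in blast)
    ultimately show False using assms by simp
  qed
  then show thesis using that by blast
qed

text \<open>Refining the scale and widening the window by \<open>M\<close> cost a factor independent
  of \<open>n\<close>. A point of \<open>T'\<close> is determined by a spanning point near it and by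
  the colours at the two ends of the window: the colours control the times near the ends, uniform
  expansivity those deep inside.\<close>

lemma card_comparison:
  assumes "\<epsilon>' > 0" "2 * \<epsilon> \<le> expansivity"
  obtains C where "\<forall>n T T'. T \<subseteq> X \<longrightarrow> T' \<subseteq> X \<longrightarrow> finite T \<longrightarrow>
    separated {- int M..<int n + int M} \<epsilon>' T' \<longrightarrow> spans {0..<int n} \<epsilon> T T' \<longrightarrow> card T' \<le> C * card T"
proof -
  obtain m :: nat where m: "\<forall>x\<in>X. \<forall>y\<in>X.
      (\<forall>i. \<bar>i\<bar> \<le> int m \<longrightarrow> dist (F i x) (F i y) \<le> expansivity) \<longrightarrow> dist x y \<le> \<epsilon>'"
    by (rule uniform_expansivity[OF assms(1)])
  \<comment> \<open>\<open>M\<close> reaches over the margin outside the window, \<open>m\<close>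
    over the times inside where the window of uniform expansivity would stick out.\<close>
  define I where "I = {- int (M + m)..int (M + m)}"
  obtain col :: "'a \<Rightarrow> nat" and K where "K > 0" and col: "col ` X \<subseteq> {..<K}"
    "\<forall>q\<in>X. \<forall>q'\<in>X. col q = col q' \<longrightarrow> (\<forall>i\<in>I. dist (F i q) (F i q') \<le> \<epsilon>')"
    by (rule colouring[of I, OF _ assms(1)]) (simp_all add: I_def)
  show thesis
  proof (rule that[of "K * K"], intro allI impI)
    fix n T T' assume T: "T \<subseteq> X" "T' \<subseteq> X" "finite T"
      and sep: "separated {- int M..<int n + int M} \<epsilon>' T'" and span: "spans {0..<int n} \<epsilon> T T'"
    obtain t where t: "\<And>u. u \<in> T' \<Longrightarrow> t u \<in> T"
      "\<And>u i. u \<in> T' \<Longrightarrow> 0 \<le> i \<Longrightarrow> i < int n \<Longrightarrow> dist (F i u) (F i (t u)) \<le> \<epsilon>"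
      using span unfolding spans_def by (metis atLeastLessThan_iff)
    define \<phi> where "\<phi> u = (t u, col u, col (F (int n) u))" for u
    have "inj_on \<phi> T'"
    proof (rule inj_onI)
      fix u v assume uv: "u \<in> T'" "v \<in> T'" "\<phi> u = \<phi> v"
      then have X: "u \<in> X" "v \<in> X" using T by auto
      have close: "dist (F i u) (F i v) \<le> expansivity" if "0 \<le> i" "i < int n" for i
      proof -
        have "dist (F i u) (F i v) \<le> dist (F i u) (F i (t u)) + dist (F i v) (F i (t u))"
          by (rule dist_triangle2)
        also have "\<dots> \<le> expansivity"
          using t(2)[OF uv(1) that] t(2)[OF uv(2) that] uv(3) assms(2) by (simp add: \<phi>_def)
        finally show ?thesis .
      qed
      have "dist (F i u) (F i v) \<le> \<epsilon>'" if i: "i \<in> {- int M..<int n + int M}" for i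
      proof -
        consider "i \<in> I" | "i - int n \<in> I" | "int m \<le> i" "i < int n - int m"
          using i unfolding I_def by fastforce
        then show ?thesis
        proof cases
          case 1
          then show ?thesis using col(2) X uv(3) by (simp add: \<phi>_def)
        next
          case 2
          then have "dist (F (i - int n) (F (int n) u)) (F (i - int n) (F (int n) v)) \<le> \<epsilon>'"
            using col(2) X uv(3) by (simp add: \<phi>_def)
          then show ?thesis using X by (simp flip: F_add)
        next
          case 3
          then show ?thesis using X close by (intro m[rule_format]) (auto simp flip: F_add)
        qed
      qed
      then show "u = v" using sep uv(1,2) unfolding separated_def by blast
    qed
    moreover have "\<phi> ` T' \<subseteq> T \<times> {..<K} \<times> {..<K}"
    proof (rule image_subsetI)
      fix u assume u: "u \<in> T'"
      then have "col u < K" "col (F (int n) u) < K"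
        using T(2) col(1) by (simp_all add: image_subset_iff subset_iff)
      then show "\<phi> u \<in> T \<times> {..<K} \<times> {..<K}" using t(1) u by (simp add: \<phi>_def)
    qed
    ultimately have "card T' \<le> card (T \<times> {..<K} \<times> {..<K})"
      by (intro card_inj_on_le) (auto simp: T(3))
    then show "card T' \<le> K * K * card T" by (simp add: card_cartesian_product mult.commute)
  qed
qed

subsection \<open>Chains and insertion of a visit\<close>

text \<open>A single step of a pseudo-orbit as a relation, so that finite pseudo-orbits of length
  \<open>n\<close> are relation powers and concatenation is their transitivity.\<close>

definition edge :: "real \<Rightarrow> ('a \<times> 'a) set" where
  "edge \<delta> = {(q, q'). q \<in> X \<and> q' \<in> X \<and> dist q' (f q) \<le> \<delta>}"

lemma edge_relpow_mono: "(q, q') \<in> edge \<delta> ^^ n \<Longrightarrow> \<delta> \<le> \<delta>' \<Longrightarrow> (q, q') \<in> edge \<delta>' ^^ n"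
  unfolding relpow_fun_conv edge_def by fastforce

lemma orbit_chain: "q \<in> X \<Longrightarrow> \<delta> \<ge> 0 \<Longrightarrow> (q, F (int n) q) \<in> edge \<delta> ^^ n"
proof (induction n)
  case (Suc n)
  have "F (int (Suc n)) q = f (F (int n) q)" using F_Suc[OF Suc.prems(1), of "int n"] by (simp add: add.commute)
  then have "(F (int n) q, F (int (Suc n)) q) \<in> edge \<delta>" using Suc.prems f_in by (simp add: edge_def)
  then show ?case using Suc by (blast intro: relpow_Suc_I)
qed simp

text \<open>For each pair of colours one transit time given by irreducibility serves all points of
  these colours, since the errors at both ends are absorbed in the jumps. There are finitely many
  pairs.\<close>

lemma uniform_chains:
  assumes "\<delta> > 0"
  obtains M where "\<forall>q\<in>X. \<forall>q'\<in>X. \<exists>n. 1 \<le> n \<and> n \<le> M \<and> (q, q') \<in> edge \<delta> ^^ n"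
proof -
  obtain col :: "'a \<Rightarrow> nat" and K where "K > 0" and col: "col ` X \<subseteq> {..<K}"
    "\<forall>q\<in>X. \<forall>q'\<in>X. col q = col q' \<longrightarrow> (\<forall>i\<in>{0}. dist (F i q) (F i q') \<le> \<delta> / 2)"
    by (rule colouring[of "{0}" "\<delta> / 2"]) (use assms in simp_all)
  \<comment> \<open>The colour of \<open>f q\<close> is used because the first jump goes from
    \<open>q\<close> to a point near \<open>f q\<close>; this jump accounts for the extra step in
    \<open>Suc n\<close>.\<close>
  have "\<exists>n. \<forall>q\<in>X. \<forall>q'\<in>X. col (f q) = c \<and> col q' = c' \<longrightarrow> (q, q') \<in> edge \<delta> ^^ Suc n" for c c'
  proof (cases "\<exists>a\<in>X. \<exists>b\<in>X. col a = c \<and> col b = c'")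
    case True
    then obtain a b where ab: "a \<in> X" "b \<in> X" "col a = c" "col b = c'" by blast
    obtain v n where v: "v \<in> X" "n \<ge> (1::nat)" "dist v a < \<delta> / 2" "dist (F (int n) v) b < \<delta> / 2"
      by (rule transitive[OF ab(1,2), of "\<delta> / 2"]) (use assms in simp_all)
    obtain k where k: "n = Suc k" using v(2) by (cases n) auto
    have "(q, q') \<in> edge \<delta> ^^ Suc n" if q: "q \<in> X" "q' \<in> X" "col (f q) = c" "col q' = c'" for q q'
    proof -
      have "dist (f q) a \<le> \<delta> / 2" "dist q' b \<le> \<delta> / 2" using col(2) ab q f_in by auto
      then have d: "dist v (f q) \<le> \<delta>" "dist q' (F (int n) v) \<le> \<delta>"
        using v(3,4) dist_triangle2[of v "f q" a] dist_triangle2[of q' "F (int n) v" b] by linarith+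
      have "F (int n) v = f (F (int k) v)" using F_Suc[OF v(1), of "int k"] k by (simp add: add.commute)
      then have "(F (int k) v, q') \<in> edge \<delta>" using d(2) v(1) q(2) by (simp add: edge_def)
      moreover have "(q, v) \<in> edge \<delta>" using d(1) v(1) q(1) by (simp add: edge_def)
      moreover have "(v, F (int k) v) \<in> edge \<delta> ^^ k" using orbit_chain[OF v(1)] assms by simp
      ultimately have "(q, q') \<in> edge \<delta> ^^ Suc (Suc k)" by (blast intro: relpow_Suc_I relpow_Suc_I2)
      then show ?thesis by (simp add: k)
    qed
    then show ?thesis by blast
  next
    case False
    then show ?thesis using f_in by blast
  qed
  then obtain N where N: "\<And>c c'. \<forall>q\<in>X. \<forall>q'\<in>X. col (f q) = c \<and> col q' = c' \<longrightarrow> (q, q') \<in> edge \<delta> ^^ Suc (N c c')"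
    by metis
  \<comment> \<open>The sum serves as an upper bound for all its terms.\<close>
  define M where "M = (\<Sum>(c, c')\<in>{..<K} \<times> {..<K}. Suc (N c c'))"
  show thesis
  proof (rule that[of M], intro ballI exI conjI)
    fix q q' assume q: "q \<in> X" "q' \<in> X"
    let ?n = "Suc (N (col (f q)) (col q'))"
    show "(q, q') \<in> edge \<delta> ^^ ?n" using N q by blast
    show "1 \<le> ?n" by simp
    have "(col (f q), col q') \<in> {..<K} \<times> {..<K}" using col(1) q f_in by (simp add: image_subset_iff)
    then show "?n \<le> M"
      unfolding M_def using member_le_sum[of "(col (f q), col q')" "{..<K} \<times> {..<K}" "\<lambda>(c, c'). Suc (N c c')"]
      by simp
  qed
qed

text \<open>Only the last jump sees the new endpoint, and the other half of \<delta> pays for it. A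
  last jump exists because \<open>n\<close> is positive.\<close>

lemma chain_perturb_end:
  assumes "(q, q') \<in> edge (\<delta> / 2) ^^ n" "n \<ge> 1" "dist q'' q' \<le> \<delta> / 2" "q'' \<in> X" "\<delta> > 0"
  shows "(q, q'') \<in> edge \<delta> ^^ n"
proof -
  obtain k where k: "n = Suc k" using assms(2) by (cases n) auto
  then obtain p where p: "(q, p) \<in> edge (\<delta> / 2) ^^ k" "(p, q') \<in> edge (\<delta> / 2)"
    using assms(1) by (auto elim: relpow_Suc_E)
  have "dist q'' (f p) \<le> \<delta>"
    using p(2) assms(3) dist_triangle[of q'' "f p" q'] by (simp add: edge_def)
  then have "(p, q'') \<in> edge \<delta>" using p(2) assms(4) by (simp add: edge_def)
  moreover have "(q, p) \<in> edge \<delta> ^^ k" using edge_relpow_mono[OF p(1)] assms(5) by simp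
  ultimately show ?thesis unfolding k by (blast intro: relpow_Suc_I)
qed

text \<open>
  By pigeonhole an orbit segment of length \<open>L\<close> contains a near-return after a time divisible by
  every possible length of a loop through \<open>x\<close>. The section between is replaced by repetitions of
  such a loop, which keeps the total length. As the loop length divides \<open>h - 1\<close>, one of the visits
  to \<open>x\<close> takes place at a multiple of \<open>h\<close>; this works without knowing the period of the system.
\<close>

lemma insertion_chain:
  assumes "\<delta> > 0" "x \<in> X"
  obtains M :: nat where "\<forall>k h. h = Suc (k * fact M) \<longrightarrow> (\<exists>L>0. h dvd L \<and> (\<forall>q\<in>X. \<exists>t u.
     t + u = L \<and> 0 < u \<and> h dvd t \<and> (q, x) \<in> edge \<delta> ^^ t \<and> (x, F (int L) q) \<in> edge \<delta> ^^ u))"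
proof -
  let ?R = "edge (\<delta> / 2)"
  obtain M0 where M0: "\<forall>q\<in>X. \<forall>q'\<in>X. \<exists>n. 1 \<le> n \<and> n \<le> M0 \<and> (q, q') \<in> ?R ^^ n"
    by (rule uniform_chains[of "\<delta> / 2"]) (use assms in simp_all)
  obtain col :: "'a \<Rightarrow> nat" and K where "K > 0" and col: "col ` X \<subseteq> {..<K}"
    "\<forall>q\<in>X. \<forall>q'\<in>X. col q = col q' \<longrightarrow> (\<forall>i\<in>{0}. dist (F i q) (F i q') \<le> \<delta> / 2)"
    by (rule colouring[of "{0}" "\<delta> / 2"]) (use assms in simp_all)
  \<comment> \<open>A loop through \<open>x\<close> consists of two chains of length at most
    \<open>M0\<close>, so its length divides \<open>fact M\<close>.\<close>
  define M where "M = 2 * M0"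
  show thesis
  proof (rule that[of M], intro allI impI)
    fix k h :: nat assume h: "h = Suc (k * fact M)"
    define P where "P = h * fact M"
    define L where "L = K * P"
    have "\<exists>t u. t + u = L \<and> 0 < u \<and> h dvd t \<and> (q, x) \<in> edge \<delta> ^^ t \<and> (x, F (int L) q) \<in> edge \<delta> ^^ u"
      if q: "q \<in> X" for q
    proof -
      \<comment> \<open>There are \<open>K + 1\<close> sampled times but only \<open>K\<close>
        colours.\<close>
      have "\<not> inj_on (\<lambda>i. col (F (int (i * P)) q)) {..K}"
      proof
        assume "inj_on (\<lambda>i. col (F (int (i * P)) q)) {..K}"
        moreover have "(\<lambda>i. col (F (int (i * P)) q)) ` {..K} \<subseteq> {..<K}"
          using col(1) q by (simp add: image_subset_iff)
        ultimately show False using card_inj_on_le[of _ "{..K}" "{..<K}"] by fastforce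
      qed
      then obtain i j where ij: "i < j" "j \<le> K" "col (F (int (i * P)) q) = col (F (int (j * P)) q)"
        unfolding inj_on_def by (metis atMost_iff linorder_neqE_nat)
      define q1 q2 where "q1 = F (int (i * P)) q" and "q2 = F (int (j * P)) q"
      have q12: "q1 \<in> X" "q2 \<in> X" "dist q2 q1 \<le> \<delta> / 2"
        using col(2) ij(3) q by (auto simp: q1_def q2_def dist_commute)
      obtain a where a: "1 \<le> a" "a \<le> M0" "(q1, x) \<in> ?R ^^ a" using M0 q12(1) assms(2) by blast
      obtain b where b: "1 \<le> b" "b \<le> M0" "(x, q1) \<in> ?R ^^ b" using M0 q12(1) assms(2) by blast
      have "a + b dvd fact M" using a b by (intro dvd_fact) (auto simp: M_def)
      then obtain e where e: "fact M = (a + b) * e" by (auto elim: dvdE)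
      then have "e > 0" by (metis fact_nonzero gr0I mult_0_right)
      have "a \<le> fact M" using a fact_ge_self[of M] by (simp add: M_def)
      \<comment> \<open>The number of loops run before the marked visit. Since
        \<open>s * (a + b)\<close> equals \<open>a * (h - 1)\<close>, the visit comes
        \<open>a * h\<close> steps after \<open>q1\<close>.\<close>
      define s where "s = e * k * a"
      \<comment> \<open>The number of loops of length \<open>a + b\<close> that fill the removed
        section exactly.\<close>
      define c where "c = (j - i) * h * e"
      have s: "a + s * (a + b) = a * h" unfolding s_def h e by (simp add: algebra_simps)
      have "s + e \<le> h * e"
        using \<open>a \<le> fact M\<close> by (simp add: s_def h algebra_simps)
      moreover have "h * e \<le> c"
      proof -
        obtain d where "j - i = Suc d" using ij(1) by (cases "j - i") auto
        then show ?thesis by (simp add: c_def)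
      qed
      ultimately have sc: "s < c" using \<open>e > 0\<close> by simp
      have cl: "c * (a + b) = (j - i) * P" by (simp add: c_def P_def e mult_ac)
      have mono: "(y, y') \<in> edge \<delta> ^^ n" if "(y, y') \<in> ?R ^^ n" for y y' n
        using edge_relpow_mono[OF that] assms(1) by simp
      have loop: "(x, x) \<in> edge \<delta> ^^ (n * (a + b))" for n
        by (rule relpow_loop) (metis mono relpow_trans[OF b(3) a(3)] add.commute)
      define t where "t = i * P + (a + s * (a + b))"
      \<comment> \<open>The last \<open>b\<close> steps are redirected from \<open>q1\<close> to the
        nearby \<open>q2\<close>, where the original orbit resumes.\<close>
      define u where "u = (c - s - 1) * (a + b) + b + (K - j) * P"
      have "(q, q1) \<in> edge \<delta> ^^ (i * P)"
        unfolding q1_def by (rule orbit_chain) (use q assms in simp_all)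
      then have 1: "(q, x) \<in> edge \<delta> ^^ t"
        unfolding t_def by (rule relpow_trans[OF _ relpow_trans[OF mono[OF a(3)] loop]])
      have "F (int ((K - j) * P)) q2 = F (int L) q"
      proof -
        have "int L = int ((K - j) * P) + int (j * P)"
          using ij(2) by (simp add: L_def of_nat_diff algebra_simps)
        then show ?thesis unfolding q2_def using F_add[OF q] by simp
      qed
      then have "(q2, F (int L) q) \<in> edge \<delta> ^^ ((K - j) * P)"
        using orbit_chain[OF q12(2), of \<delta> "(K - j) * P"] assms by simp
      moreover have "(x, q2) \<in> edge \<delta> ^^ b"
        by (rule chain_perturb_end[OF b(3,1) q12(3,2) assms(1)])
      ultimately have 2: "(x, F (int L) q) \<in> edge \<delta> ^^ u"
        unfolding u_def using relpow_trans[OF relpow_trans[OF loop]] by blast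
      have "(a + s * (a + b)) + ((c - s - 1) * (a + b) + b) = (s + (c - s - 1) + 1) * (a + b)"
        by (simp add: algebra_simps)
      also have "s + (c - s - 1) + 1 = c" using sc by simp
      finally have "t + u = i * P + (j - i) * P + (K - j) * P" unfolding t_def u_def cl by simp
      also have "\<dots> = L" using ij by (simp add: L_def flip: add_mult_distrib)
      finally have "t + u = L" .
      moreover have "h dvd t" unfolding t_def s by (simp add: P_def)
      moreover have "0 < u" using b(1) by (simp add: u_def)
      ultimately show ?thesis using 1 2 by blast
    qed
    moreover have "L > 0" using \<open>K > 0\<close> by (simp add: L_def P_def h)
    moreover have "h dvd L" by (simp add: L_def P_def)
    ultimately show "\<exists>L>0. h dvd L \<and> (\<forall>q\<in>X. \<exists>t u. t + u = L \<and> 0 < u \<and> h dvd t \<and>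
        (q, x) \<in> edge \<delta> ^^ t \<and> (x, F (int L) q) \<in> edge \<delta> ^^ u)"
      by blast
  qed
qed

text \<open>Division with remainder by \<open>L\<close> glues the blocks into one two-sided
  pseudo-orbit. Each block is also described at time \<open>L\<close>, where it must agree with the
  start of the next one.\<close>

lemma block_tracing:
  fixes w :: "int \<Rightarrow> nat \<Rightarrow> 'a"
  assumes "L > 0" and trace: "\<forall>u. pseudo_orbit X f \<delta> u \<longrightarrow> (\<exists>x\<in>X. traced_by X f \<epsilon> u x)"
    and w: "\<And>i s. s < L \<Longrightarrow> (w i s, w i (Suc s)) \<in> edge \<delta>" "\<And>i. w i L = w (i + 1) 0"
  obtains z where "z \<in> X" "\<forall>i s. s < L \<longrightarrow> dist (F (i * int L + int s) z) (w i s) \<le> \<epsilon>"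
proof -
  define u where "u n = w (n div int L) (nat (n mod int L))" for n
  have u: "u (i * int L + int s) = w i s" if "s < L" for i s
    using that by (simp add: u_def)
  have "(u n, u (n + 1)) \<in> edge \<delta>" for n
  proof -
    define i s where "i = n div int L" and "s = nat (n mod int L)"
    have s: "s < L" and n: "n = i * int L + int s"
      using assms(1) by (simp_all add: i_def s_def nat_less_iff)
    have "u (n + 1) = w i (Suc s)"
    proof (cases "Suc s < L")
      case True
      then show ?thesis using u[OF True, of i] n by (simp add: algebra_simps)
    next
      case False
      then have "n + 1 = (i + 1) * int L + int 0" using s n by (simp add: algebra_simps)
      then have "u (n + 1) = w (i + 1) 0" using u[OF assms(1)] by metis
      then show ?thesis using w(2)[of i] False s by (metis Suc_lessI)
    qed
    then show ?thesis using w(1)[OF s] u[OF s] n by simp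
  qed
  then have "pseudo_orbit X f \<delta> u" by (auto simp: pseudo_orbit_def edge_def)
  then obtain z where z: "z \<in> X" "\<forall>n. dist (u n) (F n z) \<le> \<epsilon>"
    using trace unfolding traced_by_def by blast
  show thesis
    using z u by (intro that[of z]) (metis dist_commute)+
qed

subsection \<open>Orbits avoiding a ball\<close>

text \<open>
  The bound is an injection. A function \<open>g\<close> into \<open>{..K}\<close> encodes the set of blocks that receive a
  visit to \<open>x\<close>, namely those where \<open>g\<close> is \<open>K\<close>. The resulting orbit determines this set, as the
  original orbits avoid \<open>x\<close>, and the original orbit outside these blocks; what happened inside
  them is recorded by one of \<open>K\<close> colours, in the slots of \<open>g\<close> that would otherwise be constant.
\<close>

lemma avoiding_separated_card:
  assumes "x \<in> X" "\<epsilon> > 0" "\<rho> > 0"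
  obtains \<epsilon>' M where "\<epsilon>' > 0"
    "\<forall>k h. h = Suc (k * fact M) \<longrightarrow> (\<exists>L>0. \<exists>K>0. \<forall>n S T. S \<subseteq> X \<longrightarrow>
       separated {0..<int (n * L)} \<epsilon> S \<longrightarrow> (\<forall>z\<in>S. \<forall>j. \<rho> \<le> dist (F (j * int h) z) x) \<longrightarrow>
       finite T \<longrightarrow> T \<subseteq> X \<longrightarrow> spans {0..<int (n * L)} \<epsilon>' T X \<longrightarrow>
       card S * Suc K ^ n \<le> card T * K ^ n)"
proof -
  \<comment> \<open>Comparing two constructed orbits costs \<open>4 * \<epsilon>'\<close>, which has
    to be less than \<rho> to detect visits and at most \<epsilon> to contradict separation.\<close>
  define \<epsilon>' where "\<epsilon>' = min (\<rho> / 5) (\<epsilon> / 4)"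
  have \<epsilon>': "\<epsilon>' > 0" "4 * \<epsilon>' < \<rho>" "4 * \<epsilon>' \<le> \<epsilon>" using assms by (simp_all add: \<epsilon>'_def min_def field_simps)
  obtain \<delta> where \<delta>: "\<delta> > 0" "\<forall>u. pseudo_orbit X f \<delta> u \<longrightarrow> (\<exists>x\<in>X. traced_by X f \<epsilon>' u x)"
    by (rule shadowing[OF \<epsilon>'(1)])
  obtain M where M: "\<forall>k h. h = Suc (k * fact M) \<longrightarrow> (\<exists>L>0. h dvd L \<and> (\<forall>q\<in>X. \<exists>t u.
     t + u = L \<and> 0 < u \<and> h dvd t \<and> (q, x) \<in> edge \<delta> ^^ t \<and> (x, F (int L) q) \<in> edge \<delta> ^^ u))"
    by (rule insertion_chain[OF \<delta>(1) assms(1)])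
  have "\<exists>L>0. \<exists>K>0. \<forall>n S T. S \<subseteq> X \<longrightarrow>
       separated {0..<int (n * L)} \<epsilon> S \<longrightarrow> (\<forall>z\<in>S. \<forall>j. \<rho> \<le> dist (F (j * int h) z) x) \<longrightarrow>
       finite T \<longrightarrow> T \<subseteq> X \<longrightarrow> spans {0..<int (n * L)} \<epsilon>' T X \<longrightarrow>
       card S * Suc K ^ n \<le> card T * K ^ n" if hk: "h = Suc (k * fact M)" for k h
  proof -
    obtain L where L: "L > 0" "h dvd L" and ins: "\<forall>q\<in>X. \<exists>t u.
     t + u = L \<and> 0 < u \<and> h dvd t \<and> (q, x) \<in> edge \<delta> ^^ t \<and> (x, F (int L) q) \<in> edge \<delta> ^^ u"
      using M[rule_format, OF hk] by blast
    have "\<exists>v t. t < L \<and> h dvd t \<and> v 0 = q \<and> v t = x \<and> v L = F (int L) q \<and>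
        (\<forall>i<L. (v i, v (Suc i)) \<in> edge \<delta>)" if q: "q \<in> X" for q
    proof -
      obtain t u where tu: "t + u = L" "0 < u" "h dvd t" "(q, x) \<in> edge \<delta> ^^ t"
        "(x, F (int L) q) \<in> edge \<delta> ^^ u"
        using ins q by blast
      obtain v where v: "v 0 = q" "v t = x" "v (t + u) = F (int L) q"
        "\<forall>i<t + u. (v i, v (Suc i)) \<in> edge \<delta>"
        by (rule chain_through[OF tu(4,5)])
      have "t < L" using tu(1,2) by simp
      then show ?thesis using v tu(1,3) by blast
    qed
    then obtain v t where v: "\<forall>q\<in>X. t q < L \<and> h dvd t q \<and> v q 0 = q \<and> v q (t q) = x \<and>
        v q L = F (int L) q \<and> (\<forall>i<L. (v q i, v q (Suc i)) \<in> edge \<delta>)"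
      by metis
    obtain col :: "'a \<Rightarrow> nat" and K where "K > 0" and col: "col ` X \<subseteq> {..<K}"
      "\<forall>q\<in>X. \<forall>q'\<in>X. col q = col q' \<longrightarrow> (\<forall>i\<in>{0..<int L}. dist (F i q) (F i q') \<le> \<epsilon>)"
      by (rule colouring[of "{0..<int L}" \<epsilon>]) (use assms in simp_all)
    define b where "b z i = F (i * int L) z" for z i
    \<comment> \<open>The orbit of \<open>z\<close> with a detour through \<open>x\<close> in the
      blocks numbered by \<open>J\<close>. Both kinds of block have the same endpoints, so any
      choice of \<open>J\<close> fits together.\<close>
    define w where "w J z i s = (if 0 \<le> i \<and> nat i \<in> J then v (b z i) s else F (int s) (b z i))" for J z i s
    have b: "b z i \<in> X" if "z \<in> X" for z i using that by (simp add: b_def)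
    have bS: "F (int L) (b z i) = b z (i + 1)" if "z \<in> X" for z i
      using F_add[OF that, of "int L" "i * int L"] by (simp add: b_def algebra_simps)
    have "\<exists>y\<in>X. \<forall>i s. s < L \<longrightarrow> dist (F (i * int L + int s) y) (w J z i s) \<le> \<epsilon>'" if z: "z \<in> X" for J z
    proof -
      have "(w J z i s, w J z i (Suc s)) \<in> edge \<delta>" if "s < L" for i s
      proof (cases "0 \<le> i \<and> nat i \<in> J")
        case True
        then show ?thesis using v b[OF z] that by (simp add: w_def)
      next
        case False
        then have "w J z i s' = F (int s') (b z i)" for s' by (auto simp: w_def)
        then show ?thesis using F_Suc[OF b[OF z], of "int s" i] b[OF z] \<delta>(1) f_in
          by (simp add: edge_def add.commute)
      qed
      moreover have "w J z i L = w J z (i + 1) 0" for i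
        using v b[OF z] bS[OF z] by (simp add: w_def)
      ultimately show ?thesis
        using block_tracing[OF L(1) \<delta>(2), of "w J z"] by blast
    qed
    then have "\<forall>J. \<forall>z\<in>X. \<exists>y. y \<in> X \<and> (\<forall>i s. s < L \<longrightarrow> dist (F (i * int L + int s) y) (w J z i s) \<le> \<epsilon>')"
      by blast
    then obtain \<zeta> where "\<forall>J. \<forall>z\<in>X. \<zeta> J z \<in> X \<and>
        (\<forall>i s. s < L \<longrightarrow> dist (F (i * int L + int s) (\<zeta> J z)) (w J z i s) \<le> \<epsilon>')"
      by metis
    then have \<zeta>: "\<And>z J. z \<in> X \<Longrightarrow> \<zeta> J z \<in> X"
      "\<And>z J i s. z \<in> X \<Longrightarrow> s < L \<Longrightarrow> dist (F (i * int L + int s) (\<zeta> J z)) (w J z i s) \<le> \<epsilon>'"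
      by blast+
    have "card S * Suc K ^ n \<le> card T * K ^ n"
      if S: "S \<subseteq> X" "separated {0..<int (n * L)} \<epsilon> S" "\<forall>z\<in>S. \<forall>j. \<rho> \<le> dist (F (j * int h) z) x"
        and T: "finite T" "T \<subseteq> X" "spans {0..<int (n * L)} \<epsilon>' T X" for n S T
    proof -
      obtain near where near: "\<And>p. p \<in> X \<Longrightarrow> near p \<in> T"
        "\<And>p i. p \<in> X \<Longrightarrow> i \<in> {0..<int (n * L)} \<Longrightarrow> dist (F i p) (F i (near p)) \<le> \<epsilon>'"
        using T(3) unfolding spans_def by metis
      have range: "int i * int L + int s \<in> {0..<int (n * L)}" if "i < n" "s < L" for i s
      proof -
        have "i * L + s < Suc i * L" using that by simp
        also have "\<dots> \<le> n * L" using that by (intro mult_le_mono1) simp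
        finally show ?thesis by (simp flip: of_nat_mult of_nat_add)
      qed
      \<comment> \<open>Four errors add up: one tracing error and one spanning error for each of the
        two orbits.\<close>
      have w_close: "dist (w J z (int i) s) (w J' z' (int i) s) \<le> 4 * \<epsilon>'"
        if "z \<in> X" "z' \<in> X" "near (\<zeta> J z) = near (\<zeta> J' z')" "i < n" "s < L" for z z' J J' i s
      proof -
        let ?m = "int i * int L + int s"
        have 1: "dist (F ?m (\<zeta> J z)) (w J z (int i) s) \<le> \<epsilon>'" "dist (F ?m (\<zeta> J' z')) (w J' z' (int i) s) \<le> \<epsilon>'"
          using \<zeta>(2) that by auto
        have 2: "dist (F ?m (\<zeta> J z)) (F ?m (near (\<zeta> J z))) \<le> \<epsilon>'"
          "dist (F ?m (\<zeta> J' z')) (F ?m (near (\<zeta> J z))) \<le> \<epsilon>'"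
          using near(2)[OF \<zeta>(1) range[OF that(4,5)]] that(1,2,3) by metis+
        have "dist (F ?m (\<zeta> J z)) (F ?m (\<zeta> J' z')) \<le> 2 * \<epsilon>'"
          using 2 dist_triangle2[of "F ?m (\<zeta> J z)" "F ?m (\<zeta> J' z')" "F ?m (near (\<zeta> J z))"] by linarith
        then show ?thesis
          using 1 dist_triangle2[of "w J z (int i) s" "w J' z' (int i) s" "F ?m (\<zeta> J' z')"]
            dist_triangle[of "w J z (int i) s" "F ?m (\<zeta> J' z')" "F ?m (\<zeta> J z)"]
          by (simp add: dist_commute)
      qed
      have J_sub: "i \<in> J'" if "z \<in> S" "z' \<in> S" "near (\<zeta> J z) = near (\<zeta> J' z')" "i < n" "i \<in> J" for z z' J J' i
      proof (rule ccontr)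
        assume "i \<notin> J'"
        have X: "z \<in> X" "z' \<in> X" using that S(1) by auto
        define s where "s = t (b z (int i))"
        have s: "s < L" "h dvd s" "v (b z (int i)) s = x" using v b[OF X(1)] by (simp_all add: s_def)
        \<comment> \<open>The detour meets \<open>x\<close> at a multiple of \<open>h\<close>. If
          \<open>z'\<close> had no detour in block \<open>i\<close>, its own orbit would be close to
          \<open>x\<close> at such a time, which is excluded.\<close>
        have "h dvd i * L + s" using L(2) s(2) by simp
        then obtain j where j: "i * L + s = h * j" by (auto elim: dvdE)
        have "F (int s) (b z' (int i)) = F (int s + int i * int L) z'"
          unfolding b_def using F_add[OF X(2)] by simp
        also have "int s + int i * int L = int j * int h"
          using j by (metis add.commute mult.commute of_nat_add of_nat_mult)
        finally have "dist (F (int j * int h) z') x \<le> 4 * \<epsilon>'"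
          using w_close[OF X that(3,4) s(1)] s(3) that(5) \<open>i \<notin> J'\<close> by (simp add: w_def dist_commute)
        then show False using S(3) that(2) \<epsilon>'(2) by (smt (verit))
      qed
      define G where "G = {..<n} \<rightarrow>\<^sub>E {..K}"
      define J where "J g = {i. i < n \<and> g i = K}" for g :: "nat \<Rightarrow> nat"
      define \<Phi> where "\<Phi> = (\<lambda>(z, g). (near (\<zeta> (J g) z),
        restrict (\<lambda>i. if g i = K then col (b z (int i)) else g i) {..<n}))"
      have "inj_on \<Phi> (S \<times> G)"
      proof (rule inj_onI, clarify)
        fix z g z' g' assume S': "z \<in> S" "z' \<in> S" and G: "g \<in> G" "g' \<in> G" and eq: "\<Phi> (z, g) = \<Phi> (z', g')"
        have X: "z \<in> X" "z' \<in> X" using S' S(1) by auto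
        have near_eq: "near (\<zeta> (J g) z) = near (\<zeta> (J g') z')" using eq by (simp add: \<Phi>_def)
        have col_eq: "(if g i = K then col (b z (int i)) else g i) =
            (if g' i = K then col (b z' (int i)) else g' i)" if "i < n" for i
          using eq that unfolding \<Phi>_def by (auto dest!: fun_cong[of _ _ i])
        have "i \<in> J g'" if "i \<in> J g" for i
          using J_sub[OF S' near_eq] that by (simp add: J_def)
        moreover have "i \<in> J g" if "i \<in> J g'" for i
          using J_sub[OF S'(2,1) near_eq[symmetric]] that by (simp add: J_def)
        ultimately have J_eq: "J g = J g'" by blast
        then have K_eq: "g i = K \<longleftrightarrow> g' i = K" if "i < n" for i
          using that unfolding J_def by blast
        \<comment> \<open>On \<open>J g\<close> both functions equal \<open>K\<close>; elsewhere the
          second component of \<open>\<Phi>\<close> returns their values.\<close>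
        have "g = g'"
        proof (rule PiE_ext)
          show "g \<in> {..<n} \<rightarrow>\<^sub>E {..K}" "g' \<in> {..<n} \<rightarrow>\<^sub>E {..K}" using G by (simp_all add: G_def)
          show "g i = g' i" if "i \<in> {..<n}" for i
            using col_eq[of i] K_eq[of i] that by (cases "g i = K") simp_all
        qed
        moreover have "dist (F m z) (F m z') \<le> \<epsilon>" if m: "m \<in> {0..<int (n * L)}" for m
        proof -
          define i s where "i = nat m div L" and "s = nat m mod L"
          have "nat m < n * L" using m by (simp add: nat_less_iff)
          then have i: "i < n" "s < L" using L(1) by (simp_all add: i_def s_def less_mult_imp_div_less)
          have "nat m = i * L + s" by (simp add: i_def s_def)
          then have m_eq: "m = int s + int i * int L" using m
            by (metis add.commute atLeastLessThan_iff int_nat_eq of_nat_add of_nat_mult)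
          have F_m: "F m y = F (int s) (b y (int i))" if "y \<in> X" for y
            unfolding b_def m_eq by (rule F_add[OF that])
          show ?thesis
          \<comment> \<open>In a detour block the recorded colour gives closeness; in any other
            block the constructed orbit still follows the original one.\<close>
          proof (cases "i \<in> J g")
            case True
            then have "col (b z (int i)) = col (b z' (int i))"
              using col_eq[OF i(1)] K_eq[OF i(1)] by (simp add: J_def)
            then show ?thesis using col(2) b X i(2) F_m by simp
          next
            case False
            then show ?thesis
              using w_close[OF X near_eq i] J_eq F_m X \<epsilon>'(3) by (simp add: w_def)
          qed
        qed
        then have "z = z'" using S(2) S' unfolding separated_def by blast
        ultimately show "z = z' \<and> g = g'" by simp
      qed
      moreover have "\<Phi> ` (S \<times> G) \<subseteq> T \<times> ({..<n} \<rightarrow>\<^sub>E {..<K})"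
      proof (rule image_subsetI, clarify)
        fix z g assume z: "z \<in> S" and g: "g \<in> G"
        then have "z \<in> X" using S(1) by blast
        have "(if g i = K then col (b z (int i)) else g i) < K" if "i < n" for i
        proof -
          have "g i \<le> K" using g that by (auto simp: G_def dest: PiE_mem)
          then show ?thesis using col(1) b[OF \<open>z \<in> X\<close>] by (auto simp: image_subset_iff)
        qed
        then show "\<Phi> (z, g) \<in> T \<times> ({..<n} \<rightarrow>\<^sub>E {..<K})"
          using near(1) \<zeta>(1) \<open>z \<in> X\<close> by (simp add: \<Phi>_def PiE_def Pi_def)
      qed
      moreover have "finite (T \<times> ({..<n} \<rightarrow>\<^sub>E {..<K}))" using T(1) by (simp add: finite_PiE)
      ultimately have "card (S \<times> G) \<le> card (T \<times> ({..<n} \<rightarrow>\<^sub>E {..<K}))" by (rule card_inj_on_le)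
      then show ?thesis by (simp add: G_def card_cartesian_product card_PiE)
    qed
    note * = this
    show ?thesis
      by (rule exI[of _ L], rule conjI[OF L(1)], rule exI[of _ K], rule conjI[OF \<open>K > 0\<close>],
          intro allI impI, rule *)
  qed
  then show thesis by (intro that[OF \<epsilon>'(1)] allI impI)
qed

subsection \<open>Homoclinic points and endomorphisms\<close>

lemma homoclinic_iff:
  "homoclinic X f x y \<longleftrightarrow> (\<forall>\<epsilon>>0. \<exists>N. \<forall>n. N \<le> \<bar>n\<bar> \<longrightarrow> dist (F n x) (F n y) < \<epsilon>)"
  unfolding homoclinic_def tendsto_iff eventually_filtercomap_at_top_linorder
  by (simp add: dist_real_def)

lemma homoclinic_join:
  assumes "homoclinic X f x y" "homoclinic X f x z"
  shows "homoclinic X f y z"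
  unfolding homoclinic_iff
proof (intro allI impI)
  fix \<epsilon> :: real assume "\<epsilon> > 0"
  then obtain N N' where N: "\<forall>n. N \<le> \<bar>n\<bar> \<longrightarrow> dist (F n x) (F n y) < \<epsilon> / 2"
    "\<forall>n. N' \<le> \<bar>n\<bar> \<longrightarrow> dist (F n x) (F n z) < \<epsilon> / 2"
    using assms unfolding homoclinic_iff by (meson half_gt_zero)
  then have "dist (F n y) (F n z) < \<epsilon>" if "max N N' \<le> \<bar>n\<bar>" for n
    using that by (meson dist_triangle_half_r max.bounded_iff)
  then show "\<exists>N. \<forall>n. N \<le> \<bar>n\<bar> \<longrightarrow> dist (F n y) (F n z) < \<epsilon>" by blast
qed

lemma endo_F:
  assumes "system_endomorphism X f \<tau>" "x \<in> X"
  shows "\<tau> (F n x) = F n (\<tau> x)"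
proof -
  have \<tau>: "\<tau> y \<in> X" "\<tau> (f y) = f (\<tau> y)" if "y \<in> X" for y
    using assms(1) that unfolding system_endomorphism_def by auto
  show ?thesis
  proof (induction n rule: int_induct[where k = 0])
    case (step1 i)
    then show ?case using \<tau> assms(2) by (simp add: F_Suc)
  next
    case (step2 i)
    have "f (\<tau> (F (i - 1) x)) = F i (\<tau> x)"
      using \<tau>(2)[of "F (i - 1) x"] F_Suc[OF assms(2), of "i - 1"] step2 assms(2) by simp
    moreover have "\<tau> (F (i - 1) x) \<in> X" using \<tau>(1) assms(2) by simp
    ultimately have "\<tau> (F (i - 1) x) = inv_into X f (F i (\<tau> x))" using inv_f by metis
    then show ?case using F_pred \<tau>(1) assms(2) by simp
  qed simp
qed

lemma endo_unif_cont:
  assumes "system_endomorphism X f \<tau>" "\<epsilon> > 0"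
  obtains \<kappa> where "\<kappa> > 0" "\<forall>x\<in>X. \<forall>y\<in>X. dist x y \<le> \<kappa> \<longrightarrow> dist (\<tau> x) (\<tau> y) \<le> \<epsilon>"
proof -
  have "uniformly_continuous_on X \<tau>"
    using assms(1) compact_X unfolding system_endomorphism_def by (blast intro: compact_uniformly_continuous)
  then obtain d where d: "d > 0" "\<forall>x\<in>X. \<forall>y\<in>X. dist y x < d \<longrightarrow> dist (\<tau> y) (\<tau> x) < \<epsilon>"
    unfolding uniformly_continuous_on_def using assms(2) by blast
  show thesis
  proof (rule that[of "d / 2"], use d(1) in simp, intro ballI impI)
    fix x y assume "x \<in> X" "y \<in> X" "dist x y \<le> d / 2"
    moreover from this have "dist x y < d" using d(1) by linarith
    ultimately show "dist (\<tau> x) (\<tau> y) \<le> \<epsilon>" using d(2) by (simp add: less_imp_le)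
  qed
qed

section \<open>The Moore property\<close>

text \<open>
  If \<open>x \<noteq> y\<close> are homoclinic with the same image, then every passage of an orbit near \<open>x\<close> can be
  replaced by one near \<open>y\<close> without changing the image. The replacement is made only well inside a
  long passage, where expansivity forces the orbit so close to \<open>x\<close> that a pseudo-orbit results.
\<close>

lemma avoiding_preimage:
  assumes endo: "system_endomorphism X f \<tau>" and xy: "x \<in> X" "y \<in> X" "x \<noteq> y" "\<tau> x = \<tau> y"
    and hom: "homoclinic X f x y"
  obtains a \<rho> l where "a \<in> X" "\<rho> > 0"
    "\<forall>h>l. \<forall>z\<in>X. \<exists>z'\<in>X. \<tau> z' = \<tau> z \<and> (\<forall>j. \<rho> \<le> dist (F (j * int h) z') a)"
proof -
  have \<tau>X: "\<tau> q \<in> X" if "q \<in> X" for q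
    using endo that unfolding system_endomorphism_def by auto
  obtain \<kappa>0 where \<kappa>0: "\<kappa>0 > 0" "\<forall>q\<in>X. \<forall>q'\<in>X. dist q q' \<le> \<kappa>0 \<longrightarrow> dist (\<tau> q) (\<tau> q') \<le> expansivity / 2"
    by (rule endo_unif_cont[OF endo, of "expansivity / 2"]) (use expansivity_pos in simp_all)
  \<comment> \<open>Points within \<kappa> have images within half the expansivity constant, and
    \<kappa>-closeness throughout a passage also lies within the range of uniform
    expansivity.\<close>
  define \<kappa> where "\<kappa> = min \<kappa>0 expansivity"
  have \<kappa>: "\<kappa> > 0" "\<kappa> \<le> \<kappa>0" "\<kappa> \<le> expansivity"
    using \<kappa>0(1) expansivity_pos by (simp_all add: \<kappa>_def)
  obtain \<delta> where \<delta>: "\<delta> > 0" "\<forall>u. pseudo_orbit X f \<delta> u \<longrightarrow> (\<exists>x\<in>X. traced_by X f (\<kappa> / 2) u x)"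
    by (rule shadowing[of "\<kappa> / 2"]) (use \<kappa> in simp_all)
  obtain m :: nat where m: "\<forall>x\<in>X. \<forall>y\<in>X.
      (\<forall>i. \<bar>i\<bar> \<le> int m \<longrightarrow> dist (F i x) (F i y) \<le> expansivity) \<longrightarrow> dist x y \<le> \<delta> / 2"
    by (rule uniform_expansivity[of "\<delta> / 2"]) (use \<delta> in simp_all)
  obtain N0 where N0: "\<forall>n. N0 \<le> \<bar>n\<bar> \<longrightarrow> dist (F n x) (F n y) < \<delta> / 2"
    using hom \<delta>(1) unfolding homoclinic_iff by (meson half_gt_zero)
  \<comment> \<open>A time at which \<open>x\<close> and \<open>y\<close> are visibly apart; it
    later reveals which of the two an orbit follows.\<close>
  obtain e0 where e0: "dist (F e0 x) (F e0 y) > expansivity"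
    using expansivity[OF xy(1,2)] xy(3) by (meson not_le)
  define N where "N = nat \<bar>N0\<bar> + nat \<bar>e0\<bar>"
  have N: "N0 \<le> int N" "\<bar>e0\<bar> \<le> int N" unfolding N_def by linarith+
  \<comment> \<open>\<open>c\<close> is the position of time \<open>0\<close> of \<open>x\<close>
    within the passage \<open>{0..l}\<close>. The switching times \<open>m + 1\<close> and
    \<open>l - m\<close> are then at least \<open>N\<close> away from it, where \<open>x\<close> and
    \<open>y\<close> are close, while \<open>e0\<close> falls strictly between them.\<close>
  define c where "c = m + 1 + N"
  define l where "l = 2 * c"
  define a b where "a = F (- int c) x" and "b = F (- int c) y"
  have ab: "a \<in> X" "b \<in> X" using xy by (simp_all add: a_def b_def)
  have F_ab: "F i a = F (i - int c) x" "F i b = F (i - int c) y" for i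
    using F_add[of x i "- int c"] F_add[of y i "- int c"] xy by (simp_all add: a_def b_def)
  have edge_ab: "dist (F i a) (F i b) < \<delta> / 2" if "i = int m + 1 \<or> i = int l - int m" for i
    unfolding F_ab using that N(1) by (intro N0[rule_format]) (auto simp: l_def c_def)
  define e where "e = nat (e0 + int c)"
  have e_int: "int e = e0 + int c" using N(2) by (simp add: e_def c_def)
  have e: "m < e" "e < l - m" "e \<le> l"
    using e_int N(2) by (simp_all add: l_def c_def)
  have e_ab: "dist (F (int e) a) (F (int e) b) > expansivity"
    unfolding F_ab using e_int e0 by simp
  have \<tau>_ab: "\<tau> (F i a) = \<tau> (F i b)" for i
    unfolding F_ab using endo_F[OF endo] xy by simp
  obtain \<rho> where \<rho>: "\<rho> > 0"
    "\<forall>q\<in>X. \<forall>q'\<in>X. dist q q' < \<rho> \<longrightarrow> (\<forall>i\<in>{0..int l}. dist (F i q) (F i q') < \<kappa> / 2)"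
    by (rule equicontinuous[of "{0..int l}" "\<kappa> / 2"]) (use \<kappa> in simp_all)
  define Q where "Q q \<longleftrightarrow> (\<forall>i\<in>{0..int l}. dist (F i q) (F i a) \<le> \<kappa>)" for q
  have deep: "dist (F i q) (F i a) \<le> \<delta> / 2" if "Q q" "q \<in> X" "int m \<le> i" "i \<le> int l - int m" for q i
  proof (rule m[rule_format])
    fix j :: int assume "\<bar>j\<bar> \<le> int m"
    then have "j + i \<in> {0..int l}" using that(3,4) by auto
    then have "dist (F (j + i) q) (F (j + i) a) \<le> \<kappa>" using that(1) unfolding Q_def by blast
    then show "dist (F j (F i q)) (F j (F i a)) \<le> expansivity"
      using \<kappa>(3) that(2) ab by (simp flip: F_add)
  qed (use that ab in simp_all)
  have switch: "dist (F i q) (F i b) \<le> \<delta>"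
    if "Q q" "q \<in> X" "i = int m + 1 \<or> i = int l - int m" for q i
  proof -
    have "dist (F i q) (F i a) \<le> \<delta> / 2" using that by (intro deep) (auto simp: l_def c_def)
    then show ?thesis
      using edge_ab[OF that(3)] dist_triangle[of "F i q" "F i b" "F i a"] by linarith
  qed
  have "\<exists>z'\<in>X. \<tau> z' = \<tau> z \<and> (\<forall>j. \<rho> \<le> dist (F (j * int h) z') a)" if h: "h > l" and z: "z \<in> X" for h z
  proof -
    define q where "q i = F (i * int h) z" for i
    \<comment> \<open>The orbit of \<open>b\<close> replaces that of \<open>q i\<close> strictly
      inside the passage; the first and last \<open>m\<close> steps are kept because closeness to
      \<open>a\<close> is sharpened only beyond them.\<close>
    define w where "w i s = (if Q (q i) \<and> m < s \<and> s < l - m then F (int s) b else F (int s) (q i))" for i s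
    have q: "q i \<in> X" for i using z by (simp add: q_def)
    have F_S: "F (int (Suc s)) p = f (F (int s) p)" if "p \<in> X" for s p
      using F_Suc[OF that, of "int s"] by (simp add: add.commute)
    have "(w i s, w i (Suc s)) \<in> edge \<delta>" for i s
    proof -
      have wX: "w i s \<in> X" for s using q ab by (simp add: w_def)
      have lm: "2 * m + 2 \<le> l" by (simp add: l_def c_def)
      have "dist (w i (Suc s)) (f (w i s)) \<le> \<delta>"
      proof (cases "Q (q i) \<and> m < s \<and> s < l - m")
        case True
        then have w_s: "w i s = F (int s) b" by (simp add: w_def)
        show ?thesis
        proof (cases "Suc s < l - m")
          case True
          then have "w i (Suc s) = F (int (Suc s)) b"
            using \<open>Q (q i) \<and> m < s \<and> s < l - m\<close> by (simp add: w_def del: of_nat_Suc)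
          then show ?thesis using w_s F_S[OF ab(2)] \<delta>(1) by simp
        next
          case False
          then have "w i (Suc s) = F (int (Suc s)) (q i)" by (simp add: w_def del: of_nat_Suc)
          moreover have "int (Suc s) = int l - int m"
            using False \<open>Q (q i) \<and> m < s \<and> s < l - m\<close> by linarith
          ultimately show ?thesis
            using switch[of "q i" "int (Suc s)"] F_S[OF ab(2), of s] q w_s \<open>Q (q i) \<and> m < s \<and> s < l - m\<close>
            by simp
        qed
      next
        case False
        then have w_s: "w i s = F (int s) (q i)" by (auto simp: w_def)
        show ?thesis
        proof (cases "Q (q i) \<and> m < Suc s \<and> Suc s < l - m")
          case True
          then have "w i (Suc s) = F (int (Suc s)) b" by (simp add: w_def del: of_nat_Suc)
          moreover have "int (Suc s) = int m + 1"
            using False True by linarith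
          ultimately show ?thesis
            using switch[of "q i" "int (Suc s)"] F_S[OF q, of s i] q w_s True by (simp add: dist_commute)
        next
          case False
          then have "w i (Suc s) = F (int (Suc s)) (q i)" by (auto simp: w_def simp del: of_nat_Suc)
          then show ?thesis using w_s F_S[OF q] \<delta>(1) by simp
        qed
      qed
      then show ?thesis using wX by (simp add: edge_def)
    qed
    \<comment> \<open>A block ends outside the replaced section and therefore joins the next
      one.\<close>
    moreover have "\<not> h < l - m" using h by simp
    then have "w i h = w (i + 1) 0" for i
      using F_add[OF z, of "int h" "i * int h"] by (simp add: w_def q_def algebra_simps)
    moreover have "h > 0" using h by simp
    ultimately obtain z' where z': "z' \<in> X" "\<forall>i s. s < h \<longrightarrow> dist (F (i * int h + int s) z') (w i s) \<le> \<kappa> / 2"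
      using block_tracing[OF _ \<delta>(2), of h w] by blast
    have F_z': "dist (F (int s) (F (i * int h) z')) (w i s) \<le> \<kappa> / 2" if "s < h" for i s
      using z'(2)[rule_format, OF that, of i] F_add[OF z'(1)] by (metis add.commute)
    \<comment> \<open>Half of the bound comes from tracing, half from exchanging \<open>a\<close>
      and \<open>b\<close>, whose orbits have equal images; expansivity then turns closeness into
      equality.\<close>
    have "dist (F n (\<tau> z')) (F n (\<tau> z)) \<le> expansivity" for n
    proof -
      define i s where "i = n div int h" and "s = nat (n mod int h)"
      have s: "s < h" and n: "n = i * int h + int s"
        using \<open>h > 0\<close> by (simp_all add: i_def s_def nat_less_iff)
      have wX: "w i s \<in> X" using q ab by (simp add: w_def)
      have Fz: "F n z = F (int s) (q i)"
        unfolding n q_def using F_add[OF z] by (metis add.commute)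
      have "dist (F n z') (w i s) \<le> \<kappa>0" using z'(2)[rule_format, OF s, of i] \<kappa> unfolding n by linarith
      then have 1: "dist (\<tau> (F n z')) (\<tau> (w i s)) \<le> expansivity / 2" using \<kappa>0(2) wX z'(1) by simp
      have 2: "dist (\<tau> (w i s)) (\<tau> (F n z)) \<le> expansivity / 2"
      proof (cases "Q (q i) \<and> m < s \<and> s < l - m")
        case True
        then have "int s \<in> {0..int l}" by auto
        then have "dist (F (int s) (q i)) (F (int s) a) \<le> \<kappa>" using True unfolding Q_def by blast
        then have "dist (F (int s) a) (F (int s) (q i)) \<le> \<kappa>0"
          using \<kappa>(2) by (metis dist_commute order_trans)
        then have "dist (\<tau> (F (int s) a)) (\<tau> (F (int s) (q i))) \<le> expansivity / 2"
          using \<kappa>0(2) ab q by simp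
        then show ?thesis using True \<tau>_ab by (simp add: w_def Fz)
      next
        case False
        then have "w i s = F n z" unfolding w_def Fz by auto
        then show ?thesis using expansivity_pos by simp
      qed
      from 1 2 have "dist (\<tau> (F n z')) (\<tau> (F n z)) \<le> expansivity"
        using dist_triangle[of "\<tau> (F n z')" "\<tau> (F n z)" "\<tau> (w i s)"] by linarith
      then show ?thesis using endo_F[OF endo] z z'(1) by simp
    qed
    then have "\<tau> z' = \<tau> z" using expansivity \<tau>X z z'(1) by blast
    moreover have "\<rho> \<le> dist (F (j * int h) z') a" for j
    proof (rule ccontr)
      assume "\<not> \<rho> \<le> dist (F (j * int h) z') a"
      then have near: "dist (F (int s) (F (j * int h) z')) (F (int s) a) < \<kappa> / 2" if "s \<le> l" for s
        using \<rho>(2) z'(1) ab(1) that by simp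
      show False
      \<comment> \<open>After a replacement \<open>z'\<close> follows \<open>b\<close>, which is far
        from \<open>a\<close> at time \<open>e\<close>. Without one, closeness of \<open>z'\<close>
        to \<open>a\<close> would make the block of \<open>z\<close> a passage after all.\<close>
      proof (cases "Q (q j)")
        case True
        then have "w j e = F (int e) b" using e by (simp add: w_def)
        then have "dist (F (int e) (F (j * int h) z')) (F (int e) b) \<le> \<kappa> / 2"
          using F_z'[of e j] e h by simp
        then have "dist (F (int e) a) (F (int e) b) < \<kappa>"
          using near[OF e(3)] dist_triangle3[of "F (int e) a" "F (int e) b" "F (int e) (F (j * int h) z')"]
          by linarith
        then show False using e_ab \<kappa>(3) by simp
      next
        case False
        have "dist (F (int s) (q j)) (F (int s) a) \<le> \<kappa>" if "s \<le> l" for s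
        proof -
          have "dist (F (int s) (F (j * int h) z')) (F (int s) (q j)) \<le> \<kappa> / 2"
            using F_z'[of s j] False that h by (simp add: w_def)
          then show ?thesis
            using near[OF that] dist_triangle3[of "F (int s) (q j)" "F (int s) a" "F (int s) (F (j * int h) z')"]
            by linarith
        qed
        then have "Q (q j)" unfolding Q_def by (metis atLeastAtMost_iff nonneg_int_cases of_nat_le_iff)
        then show False using False by simp
      qed
    qed
    ultimately show ?thesis using z'(1) by blast
  qed
  then show thesis by (intro that[OF ab(1) \<rho>(1)] allI impI ballI)
qed

text \<open>A right inverse \<sigma> of \<tau> with values in avoiding orbits keeps separated sets
  separated at a scale \<kappa>. Hence the avoiding orbits are as numerous as all orbits, against
  the exponential gap.\<close>

lemma Moore: "Moore_property X f"
  unfolding Moore_property_def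
proof (intro allI impI, elim conjE)
  fix \<tau> assume endo: "system_endomorphism X f \<tau>" and surj: "\<tau> ` X = X"
  show "pre_injective X f \<tau>"
  proof (rule ccontr)
    assume "\<not> pre_injective X f \<tau>"
    then obtain x0 x y where "homoclinic X f x0 x" "homoclinic X f x0 y"
      and xy: "x \<in> X" "y \<in> X" "x \<noteq> y" "\<tau> x = \<tau> y"
      unfolding pre_injective_def inj_on_def by blast
    then have hom: "homoclinic X f x y" by (rule_tac homoclinic_join)
    obtain a \<rho> l where a: "a \<in> X" "\<rho> > 0"
      and avoid: "\<forall>h>l. \<forall>z\<in>X. \<exists>z'\<in>X. \<tau> z' = \<tau> z \<and> (\<forall>j. \<rho> \<le> dist (F (j * int h) z') a)"
      by (rule avoiding_preimage[OF endo xy hom])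
    obtain \<kappa> where \<kappa>: "\<kappa> > 0" "\<forall>x\<in>X. \<forall>y\<in>X. dist x y \<le> \<kappa> \<longrightarrow> dist (\<tau> x) (\<tau> y) \<le> expansivity / 2"
      by (rule endo_unif_cont[OF endo, of "expansivity / 2"]) (use expansivity_pos in simp_all)
    obtain \<epsilon>' M where \<epsilon>': "\<epsilon>' > 0"
      and gap: "\<forall>k h. h = Suc (k * fact M) \<longrightarrow> (\<exists>L>0. \<exists>K>0. \<forall>n S T. S \<subseteq> X \<longrightarrow>
       separated {0..<int (n * L)} \<kappa> S \<longrightarrow> (\<forall>z\<in>S. \<forall>j. \<rho> \<le> dist (F (j * int h) z) a) \<longrightarrow>
       finite T \<longrightarrow> T \<subseteq> X \<longrightarrow> spans {0..<int (n * L)} \<epsilon>' T X \<longrightarrow>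
       card S * Suc K ^ n \<le> card T * K ^ n)"
      by (rule avoiding_separated_card[OF a(1) \<kappa>(1) a(2)])
    \<comment> \<open>This \<open>h\<close> has the residue that insertion requires and exceeds the
      length \<open>l\<close> of a passage.\<close>
    define h where "h = Suc (l * fact M)"
    have "l * 1 \<le> l * fact M" by (intro mult_le_mono2 fact_ge_1)
    then have "h > l" unfolding h_def by linarith
    obtain L K where "K > 0" and LK: "\<forall>n S T. S \<subseteq> X \<longrightarrow>
       separated {0..<int (n * L)} \<kappa> S \<longrightarrow> (\<forall>z\<in>S. \<forall>j. \<rho> \<le> dist (F (j * int h) z) a) \<longrightarrow>
       finite T \<longrightarrow> T \<subseteq> X \<longrightarrow> spans {0..<int (n * L)} \<epsilon>' T X \<longrightarrow>
       card S * Suc K ^ n \<le> card T * K ^ n"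
      using gap[rule_format, OF h_def] by (elim exE conjE)
    obtain C where C: "\<forall>n T T'. T \<subseteq> X \<longrightarrow> T' \<subseteq> X \<longrightarrow> finite T \<longrightarrow>
        separated {- int 0..<int n + int 0} \<epsilon>' T' \<longrightarrow> spans {0..<int n} (expansivity / 2) T T' \<longrightarrow>
        card T' \<le> C * card T"
      by (rule card_comparison[OF \<epsilon>', of "expansivity / 2" 0]) simp_all
    have "\<exists>z\<in>X. \<tau> z = t \<and> (\<forall>j. \<rho> \<le> dist (F (j * int h) z) a)" if t: "t \<in> X" for t
    proof -
      obtain z where z: "z \<in> X" "\<tau> z = t" using t surj by (metis imageE)
      then show ?thesis using avoid[rule_format, OF \<open>h > l\<close> z(1)] by simp
    qed
    then obtain \<sigma> where \<sigma>: "\<forall>t\<in>X. \<sigma> t \<in> X \<and> \<tau> (\<sigma> t) = t \<and> (\<forall>j. \<rho> \<le> dist (F (j * int h) (\<sigma> t)) a)"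
      by metis
    have "Suc K ^ n \<le> C * K ^ n" for n
    proof -
      let ?I = "{0..<int (n * L)}"
      obtain T where T: "T \<subseteq> X" "finite T" "separated ?I (expansivity / 2) T" "spans ?I (expansivity / 2) T X"
        by (rule maximal_separated[of ?I "expansivity / 2" X]) (use expansivity_pos in simp_all)
      obtain T' where T': "T' \<subseteq> X" "finite T'" "separated ?I \<epsilon>' T'" "spans ?I \<epsilon>' T' X"
        by (rule maximal_separated[of ?I \<epsilon>' X]) (use \<epsilon>' in simp_all)
      have "inj_on \<sigma> T" using \<sigma> T(1) by (metis inj_onI subsetD)
      then have card_\<sigma>: "card (\<sigma> ` T) = card T" by (rule card_image)
      have "separated ?I \<kappa> (\<sigma> ` T)"
        unfolding separated_def
      proof (intro ballI impI, clarify)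
        fix s t assume st: "s \<in> T" "t \<in> T" and close: "\<forall>i\<in>?I. dist (F i (\<sigma> s)) (F i (\<sigma> t)) \<le> \<kappa>"
        have X: "s \<in> X" "t \<in> X" using st T(1) by auto
        have "dist (F i s) (F i t) \<le> expansivity / 2" if "i \<in> ?I" for i
        proof -
          have "dist (\<tau> (F i (\<sigma> s))) (\<tau> (F i (\<sigma> t))) \<le> expansivity / 2"
            using close that \<kappa>(2) X \<sigma> by simp
          then show ?thesis using endo_F[OF endo] X \<sigma> by simp
        qed
        then show "\<sigma> s = \<sigma> t" using T(3) st unfolding separated_def by blast
      qed
      moreover have "\<sigma> ` T \<subseteq> X" "\<forall>z\<in>\<sigma> ` T. \<forall>j. \<rho> \<le> dist (F (j * int h) z) a"
        using \<sigma> T(1) by auto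
      ultimately have "card T * Suc K ^ n \<le> card T' * K ^ n"
        using LK[rule_format, of "\<sigma> ` T" n T'] T'(1,2,4) unfolding card_\<sigma> by blast
      \<comment> \<open>The gap is stated with two different scales; comparing them costs only the
        factor \<open>C\<close>.\<close>
      also have "card T' \<le> C * card T"
        using C[rule_format, of T T' "n * L"] T T' by (auto simp: spans_def)
      then have "card T' * K ^ n \<le> C * card T * K ^ n" by (rule mult_le_mono1)
      finally have "card T * Suc K ^ n \<le> card T * (C * K ^ n)" by (simp add: mult_ac)
      moreover have "card T > 0" using T(2,4) a(1) unfolding spans_def by (metis card_gt_0_iff equals0D)
      ultimately show ?thesis by simp
    qed
    then show False by (rule pow_growth[OF \<open>K > 0\<close>])
  qed
qed

section \<open>The Myhill property\<close>

text \<open>The past of \<open>x0\<close>, a chain, the segment of \<open>z\<close>, another chain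
  and the future of \<open>x0\<close> form a pseudo-orbit. The lengths \<open>a\<close> and
  \<open>b\<close> are bounded independently of the segment but may depend on \<open>z\<close>, so
  they appear in the conclusion.\<close>

lemma splicing:
  assumes "\<epsilon> > 0" "x0 \<in> X"
  obtains M :: nat where "\<forall>T. \<forall>z\<in>X. \<exists>y\<in>X. \<exists>a\<le>M. \<exists>b\<le>M.
     (\<forall>i\<in>{0..<int T}. dist (F i y) (F i z) \<le> \<epsilon>) \<and>
     (\<forall>i\<le>- int b. dist (F i y) (F (i + int b) x0) \<le> \<epsilon>) \<and>
     (\<forall>i\<ge>int T + int a. dist (F i y) (F (i - int T - int a) x0) \<le> \<epsilon>)"
proof -
  obtain \<delta> where \<delta>: "\<delta> > 0" "\<forall>u. pseudo_orbit X f \<delta> u \<longrightarrow> (\<exists>x\<in>X. traced_by X f \<epsilon> u x)"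
    by (rule shadowing[OF assms(1)])
  obtain M where M: "\<forall>q\<in>X. \<forall>q'\<in>X. \<exists>n. 1 \<le> n \<and> n \<le> M \<and> (q, q') \<in> edge \<delta> ^^ n"
    by (rule uniform_chains[OF \<delta>(1)])
  have "\<exists>y\<in>X. \<exists>a\<le>M. \<exists>b\<le>M.
     (\<forall>i\<in>{0..<int T}. dist (F i y) (F i z) \<le> \<epsilon>) \<and>
     (\<forall>i\<le>- int b. dist (F i y) (F (i + int b) x0) \<le> \<epsilon>) \<and>
     (\<forall>i\<ge>int T + int a. dist (F i y) (F (i - int T - int a) x0) \<le> \<epsilon>)" if z: "z \<in> X" for T z
  proof -
    obtain b where b: "b \<le> M" "(x0, z) \<in> edge \<delta> ^^ b" using M assms(2) z by blast
    obtain a where a: "a \<le> M" "(F (int T) z, x0) \<in> edge \<delta> ^^ a" using M assms(2) F_in[OF z] by blast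
    obtain v where v: "v 0 = x0" "v b = z" "\<forall>i<b. (v i, v (Suc i)) \<in> edge \<delta>"
      using b(2) unfolding relpow_fun_conv by blast
    obtain v' where v': "v' 0 = F (int T) z" "v' a = x0" "\<forall>i<a. (v' i, v' (Suc i)) \<in> edge \<delta>"
      using a(2) unfolding relpow_fun_conv by blast
    define u where "u n = (if n \<le> - int b then F (n + int b) x0 else if n \<le> 0 then v (nat (n + int b))
       else if n \<le> int T then F n z else if n \<le> int T + int a then v' (nat (n - int T))
       else F (n - int T - int a) x0)" for n
    \<comment> \<open>The five formulas hold on closed intervals, so neighbouring ones agree at
      shared endpoints and every step lies inside a single piece.\<close>
    have u1: "u n = F (n + int b) x0" if "n \<le> - int b" for n using that by (simp add: u_def)
    have u2: "u n = v (nat (n + int b))" if "- int b \<le> n" "n \<le> 0" for n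
      using that v(1) by (cases "n = - int b") (simp_all add: u_def)
    have u3: "u n = F n z" if "0 \<le> n" "n \<le> int T" for n
      using that u2[of n] v(2) by (cases "n = 0") (simp_all add: u_def)
    have u4: "u n = v' (nat (n - int T))" if "int T \<le> n" "n \<le> int T + int a" for n
      using that u3[of n] v'(1) by (cases "n = int T") (simp_all add: u_def)
    have u5: "u n = F (n - int T - int a) x0" if "int T + int a \<le> n" for n
      using that u4[of n] v'(2) by (cases "n = int T + int a") (simp_all add: u_def)
    have F_edge: "(F n p, F (n + 1) p) \<in> edge \<delta>" if "p \<in> X" for n p
      using F_Suc[OF that] that f_in \<delta>(1) by (simp add: edge_def)
    have "(u n, u (n + 1)) \<in> edge \<delta>" for n
    proof -
      consider "n < - int b" | "- int b \<le> n" "n < 0" | "0 \<le> n" "n < int T"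
        | "int T \<le> n" "n < int T + int a" | "int T + int a \<le> n"
        by linarith
      then show ?thesis
      proof cases
        case 1
        then show ?thesis using u1[of n] u1[of "n + 1"] F_edge[OF assms(2), of "n + int b"]
          by (simp add: algebra_simps)
      next
        case 2
        then have "nat (n + 1 + int b) = Suc (nat (n + int b))" "nat (n + int b) < b" by linarith+
        then show ?thesis using 2 u2[of n] u2[of "n + 1"] v(3) by simp
      next
        case 3
        then show ?thesis using u3[of n] u3[of "n + 1"] F_edge[OF z] by simp
      next
        case 4
        then have "nat (n + 1 - int T) = Suc (nat (n - int T))" "nat (n - int T) < a" by linarith+
        then show ?thesis using 4 u4[of n] u4[of "n + 1"] v'(3) by simp
      next
        case 5
        then show ?thesis using u5[of n] u5[of "n + 1"] F_edge[OF assms(2), of "n - int T - int a"]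
          by (simp add: algebra_simps)
      qed
    qed
    then have "pseudo_orbit X f \<delta> u" by (auto simp: pseudo_orbit_def edge_def)
    then obtain y where y: "y \<in> X" "\<forall>n. dist (u n) (F n y) \<le> \<epsilon>"
      using \<delta>(2) unfolding traced_by_def by blast
    have "dist (F i y) (F i z) \<le> \<epsilon>" if "i \<in> {0..<int T}" for i
      using y(2)[rule_format, of i] u3[of i] that by (simp add: dist_commute)
    moreover have "dist (F i y) (F (i + int b) x0) \<le> \<epsilon>" if "i \<le> - int b" for i
      using y(2)[rule_format, of i] u1[OF that] by (simp add: dist_commute)
    moreover have "dist (F i y) (F (i - int T - int a) x0) \<le> \<epsilon>" if "int T + int a \<le> i" for i
      using y(2)[rule_format, of i] u5[OF that] by (simp add: dist_commute)
    ultimately show ?thesis using y(1) a(1) b(1) by blast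
  qed
  then show thesis by (intro that allI ballI)
qed

text \<open>Far out, the whole window of uniform expansivity lies where the two orbits are within
  the constant, so closeness at this one scale improves to convergence.\<close>

lemma homoclinicI:
  assumes "x \<in> X" "y \<in> X" "\<And>i. N \<le> \<bar>i\<bar> \<Longrightarrow> dist (F i x) (F i y) \<le> expansivity"
  shows "homoclinic X f x y"
  unfolding homoclinic_iff
proof (intro allI impI)
  fix \<epsilon> :: real assume "\<epsilon> > 0"
  obtain m :: nat where m: "\<forall>x\<in>X. \<forall>y\<in>X.
      (\<forall>i. \<bar>i\<bar> \<le> int m \<longrightarrow> dist (F i x) (F i y) \<le> expansivity) \<longrightarrow> dist x y \<le> \<epsilon> / 2"
    by (rule uniform_expansivity[of "\<epsilon> / 2"]) (use \<open>\<epsilon> > 0\<close> in simp_all)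
  have "dist (F n x) (F n y) < \<epsilon>" if "N + int m \<le> \<bar>n\<bar>" for n
  proof -
    have "dist (F n x) (F n y) \<le> \<epsilon> / 2"
    proof (rule m[rule_format])
      fix i :: int assume "\<bar>i\<bar> \<le> int m"
      then have "N \<le> \<bar>i + n\<bar>" using that by linarith
      then show "dist (F i (F n x)) (F i (F n y)) \<le> expansivity"
        using assms by (simp flip: F_add)
    qed (use assms in simp_all)
    then show ?thesis using \<open>\<epsilon> > 0\<close> by linarith
  qed
  then show "\<exists>N. \<forall>n. N \<le> \<bar>n\<bar> \<longrightarrow> dist (F n x) (F n y) < \<epsilon>" by blast
qed

text \<open>Completing the segments of a spanning set by common tails and applying \<tau> yields
  distinct points of the image that are separated on a slightly longer window. So the image has, up
  to a constant, as many orbits as \<open>X\<close>, although it avoids a ball.\<close>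

lemma Myhill: "Myhill_property X f"
  unfolding Myhill_property_def
proof (intro allI impI, elim conjE)
  fix \<tau> assume endo: "system_endomorphism X f \<tau>" and pre_inj: "pre_injective X f \<tau>"
  have \<tau>X: "\<tau> ` X \<subseteq> X" and cont: "continuous_on X \<tau>"
    using endo unfolding system_endomorphism_def by auto
  show "\<tau> ` X = X"
  proof (rule ccontr)
    assume "\<tau> ` X \<noteq> X"
    then obtain x where x: "x \<in> X" "x \<notin> \<tau> ` X" using \<tau>X by blast
    have "closed (\<tau> ` X)" by (intro compact_imp_closed compact_continuous_image cont compact_X)
    then obtain \<rho> where \<rho>: "\<rho> > 0" "ball x \<rho> \<subseteq> - \<tau> ` X"
      using x(2) openE[of "- \<tau> ` X" x] by (auto simp: open_Compl)
    obtain \<epsilon>' M where \<epsilon>': "\<epsilon>' > 0"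
      and gap: "\<forall>k h. h = Suc (k * fact M) \<longrightarrow> (\<exists>L>0. \<exists>K>0. \<forall>n S T. S \<subseteq> X \<longrightarrow>
       separated {0..<int (n * L)} (expansivity / 2) S \<longrightarrow> (\<forall>z\<in>S. \<forall>j. \<rho> \<le> dist (F (j * int h) z) x) \<longrightarrow>
       finite T \<longrightarrow> T \<subseteq> X \<longrightarrow> spans {0..<int (n * L)} \<epsilon>' T X \<longrightarrow>
       card S * Suc K ^ n \<le> card T * K ^ n)"
      by (rule avoiding_separated_card[OF x(1) _ \<rho>(1), of "expansivity / 2"])
        (use expansivity_pos in simp_all)
    \<comment> \<open>The image is invariant and misses the ball at every time, so
      \<open>k = 0\<close> with \<open>h = 1\<close> is enough.\<close>
    have one: "Suc 0 = Suc (0 * fact M)" by simp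
    obtain L K where "K > 0" and LK: "\<forall>n S T. S \<subseteq> X \<longrightarrow>
       separated {0..<int (n * L)} (expansivity / 2) S \<longrightarrow> (\<forall>z\<in>S. \<forall>j. \<rho> \<le> dist (F (j * int (Suc 0)) z) x) \<longrightarrow>
       finite T \<longrightarrow> T \<subseteq> X \<longrightarrow> spans {0..<int (n * L)} \<epsilon>' T X \<longrightarrow>
       card S * Suc K ^ n \<le> card T * K ^ n"
      using gap[rule_format, OF one] by (elim exE conjE)
    obtain \<kappa> where \<kappa>: "\<kappa> > 0" "\<forall>x\<in>X. \<forall>y\<in>X. dist x y \<le> \<kappa> \<longrightarrow> dist (\<tau> x) (\<tau> y) \<le> expansivity"
      by (rule endo_unif_cont[OF endo expansivity_pos])
    \<comment> \<open>The bound by \<open>\<epsilon>'\<close> keeps different segments distinct,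
      that by \<kappa> keeps images of common tails close, and that by the expansivity constant
      makes the completed points homoclinic.\<close>
    define \<epsilon> where "\<epsilon> = min (\<epsilon>' / 2) (min (\<kappa> / 2) (expansivity / 2))"
    have \<epsilon>: "\<epsilon> > 0" "2 * \<epsilon> \<le> \<epsilon>'" "2 * \<epsilon> \<le> \<kappa>" "2 * \<epsilon> \<le> expansivity"
      using \<epsilon>' \<kappa>(1) expansivity_pos by (simp_all add: \<epsilon>_def min_def field_simps)
    obtain M' :: nat where M': "\<forall>T. \<forall>z\<in>X. \<exists>y\<in>X. \<exists>a\<le>M'. \<exists>b\<le>M'.
       (\<forall>i\<in>{0..<int T}. dist (F i y) (F i z) \<le> \<epsilon>) \<and>
       (\<forall>i\<le>- int b. dist (F i y) (F (i + int b) x) \<le> \<epsilon>) \<and>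
       (\<forall>i\<ge>int T + int a. dist (F i y) (F (i - int T - int a) x) \<le> \<epsilon>)"
      by (rule splicing[OF \<epsilon>(1) x(1)])
    obtain C where C: "\<forall>n T T'. T \<subseteq> X \<longrightarrow> T' \<subseteq> X \<longrightarrow> finite T \<longrightarrow>
        separated {- int M'..<int n + int M'} expansivity T' \<longrightarrow> spans {0..<int n} (expansivity / 2) T T' \<longrightarrow>
        card T' \<le> C * card T"
      by (rule card_comparison[OF expansivity_pos, of "expansivity / 2" M']) simp_all
    have "Suc K ^ n \<le> (Suc M' * Suc M' * C) * K ^ n" for n
    proof -
      let ?T = "n * L"
      let ?I = "{0..<int ?T}"
      obtain S where S: "S \<subseteq> \<tau> ` X" "finite S" "separated ?I (expansivity / 2) S"
          "spans ?I (expansivity / 2) S (\<tau> ` X)"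
        by (rule maximal_separated[of ?I "expansivity / 2" "\<tau> ` X"]) (use expansivity_pos \<tau>X in simp_all)
      obtain T' where T': "T' \<subseteq> X" "finite T'" "separated ?I \<epsilon>' T'" "spans ?I \<epsilon>' T' X"
        by (rule maximal_separated[of ?I \<epsilon>' X]) (use \<epsilon>' in simp_all)
      have "\<forall>z\<in>X. \<exists>y a b. y \<in> X \<and> a \<le> M' \<and> b \<le> M' \<and>
         (\<forall>i\<in>?I. dist (F i y) (F i z) \<le> \<epsilon>) \<and>
         (\<forall>i\<le>- int b. dist (F i y) (F (i + int b) x) \<le> \<epsilon>) \<and>
         (\<forall>i\<ge>int ?T + int a. dist (F i y) (F (i - int ?T - int a) x) \<le> \<epsilon>)"
        using M'[rule_format, of _ ?T] by blast
      then obtain y a b where y: "\<forall>z\<in>X. y z \<in> X \<and> a z \<le> M' \<and> b z \<le> M' \<and>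
         (\<forall>i\<in>?I. dist (F i (y z)) (F i z) \<le> \<epsilon>) \<and>
         (\<forall>i\<le>- int (b z). dist (F i (y z)) (F (i + int (b z)) x) \<le> \<epsilon>) \<and>
         (\<forall>i\<ge>int ?T + int (a z). dist (F i (y z)) (F (i - int ?T - int (a z)) x) \<le> \<epsilon>)"
        by metis
      \<comment> \<open>Equal connection lengths synchronise the tails: two completed points follow
        the orbit of \<open>x\<close> with the same time shift.\<close>
      define A where "A p = {z \<in> T'. (a z, b z) = p}" for p
      have "card (A p) \<le> C * card S" for p
      proof -
        have AX: "A p \<subseteq> X" using T'(1) by (auto simp: A_def)
        have outside: "dist (F i (y z)) (F i (y z')) \<le> 2 * \<epsilon>"
          if z: "z \<in> A p" "z' \<in> A p" and i: "i \<notin> {- int M'..<int ?T + int M'}" for z z' i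
        proof -
          have X: "z \<in> X" "z' \<in> X" using z AX by auto
          have ab: "a z' = a z" "b z' = b z" "a z \<le> M'" "b z \<le> M'"
            using z y X by (auto simp: A_def)
          have "\<exists>c. dist (F i (y z)) c \<le> \<epsilon> \<and> dist (F i (y z')) c \<le> \<epsilon>"
          proof (cases "i \<le> - int (b z)")
            case True
            then show ?thesis using y X ab by metis
          next
            case False
            then have "int ?T + int (a z) \<le> i" using i ab by auto
            then show ?thesis using y X ab by metis
          qed
          then show ?thesis by (smt (verit) dist_triangle2)
        qed
        have inj: "z = z'" if z: "z \<in> A p" "z' \<in> A p" and eq: "y z = y z'" for z z'
        proof -
          have X: "z \<in> X" "z' \<in> X" using z AX by auto
          have "dist (F i z) (F i z') \<le> \<epsilon>'" if "i \<in> ?I" for i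
          proof -
            have "dist (F i (y z)) (F i z) \<le> \<epsilon>" "dist (F i (y z)) (F i z') \<le> \<epsilon>"
              using y X that eq by metis+
            then show ?thesis
              using \<epsilon>(2) dist_triangle3[of "F i z" "F i z'" "F i (y z)"] by linarith
          qed
          then show ?thesis using T'(3) z unfolding separated_def A_def by blast
        qed
        have hom: "homoclinic X f (y z) (y z')" if "z \<in> A p" "z' \<in> A p" for z z'
        proof (rule homoclinicI)
          show "y z \<in> X" "y z' \<in> X" using y AX that by auto
          fix i assume "int ?T + int M' + 1 \<le> \<bar>i\<bar>"
          then have "i \<notin> {- int M'..<int ?T + int M'}" unfolding atLeastLessThan_iff by linarith
          then show "dist (F i (y z)) (F i (y z')) \<le> expansivity"
            using outside[OF that] \<epsilon>(4) by (meson order_trans)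
        qed
        have inj_\<tau>: "z = z'" if "z \<in> A p" "z' \<in> A p" "\<tau> (y z) = \<tau> (y z')" for z z'
        proof -
          have "y z \<in> X" "y z' \<in> X" using y AX that by auto
          then have "y z = y z'"
            using pre_inj hom[OF that(1,1)] hom[OF that(1,2)] that(3) unfolding pre_injective_def inj_on_def
            by blast
          then show ?thesis by (rule inj[OF that(1,2)])
        qed
        let ?R = "(\<lambda>z. \<tau> (y z)) ` A p"
        have RX: "?R \<subseteq> \<tau> ` X" using y AX by blast
        have "separated {- int M'..<int ?T + int M'} expansivity ?R"
          unfolding separated_def
        proof (intro ballI impI, clarify)
          fix z z' assume z: "z \<in> A p" "z' \<in> A p"
            and close: "\<forall>i\<in>{- int M'..<int ?T + int M'}. dist (F i (\<tau> (y z))) (F i (\<tau> (y z'))) \<le> expansivity"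
          have X: "y z \<in> X" "y z' \<in> X" using y AX z by auto
          have "dist (F i (\<tau> (y z))) (F i (\<tau> (y z'))) \<le> expansivity" for i
          \<comment> \<open>Beyond the connections the common tails already give closeness, so
            closeness on the window extends to all times and expansivity applies.\<close>
          proof (cases "i \<in> {- int M'..<int ?T + int M'}")
            case False
            then have "dist (F i (y z)) (F i (y z')) \<le> \<kappa>" using outside[OF z] \<epsilon>(3) by (meson order_trans)
            then have "dist (\<tau> (F i (y z))) (\<tau> (F i (y z'))) \<le> expansivity" using \<kappa>(2) X by simp
            then show ?thesis using endo_F[OF endo] X by simp
          qed (use close in blast)
          then show "\<tau> (y z) = \<tau> (y z')" using expansivity X \<tau>X by blast
        qed
        moreover have "spans ?I (expansivity / 2) S ?R" using S(4) RX unfolding spans_def by blast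
        moreover have "?R \<subseteq> X" "S \<subseteq> X" using RX S(1) \<tau>X by auto
        ultimately have "card ?R \<le> C * card S"
          using C[rule_format, of S ?R ?T] S(2) by blast
        moreover have "card ?R = card (A p)" using inj_\<tau> by (intro card_image inj_onI) blast
        ultimately show ?thesis by simp
      qed
      \<comment> \<open>Sorting by connection lengths costs only the constant factor
        \<open>Suc M' * Suc M'\<close>.\<close>
      then have "(\<Sum>p\<in>{..M'} \<times> {..M'}. card (A p)) \<le> card ({..M'} \<times> {..M'}) * (C * card S)"
        using sum_bounded_above[of "{..M'} \<times> {..M'}" "\<lambda>p. card (A p)" "C * card S"] by simp
      moreover have "T' = (\<Union>p\<in>{..M'} \<times> {..M'}. A p)" using y T'(1) by (auto simp: A_def)
      then have "card T' \<le> (\<Sum>p\<in>{..M'} \<times> {..M'}. card (A p))"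
        using card_UN_le[of "{..M'} \<times> {..M'}" A] by simp
      ultimately have card_T': "card T' \<le> Suc M' * Suc M' * C * card S"
        by (simp add: card_cartesian_product algebra_simps)
      have "\<rho> \<le> dist (F (j * int (Suc 0)) s) x" if s: "s \<in> S" for s j
      proof -
        obtain q where "q \<in> X" "s = \<tau> q" using S(1) s by blast
        then have "F (j * int (Suc 0)) s \<in> \<tau> ` X" using endo_F[OF endo] by (metis F_in imageI)
        then show ?thesis using \<rho>(2) by (force simp: dist_commute not_le[symmetric])
      qed
      then have "card S * Suc K ^ n \<le> card T' * K ^ n"
        using LK[rule_format, of S n T'] S(1,3) \<tau>X T'(1,2,4) by blast
      also have "\<dots> \<le> Suc M' * Suc M' * C * card S * K ^ n" using card_T' by (rule mult_le_mono1)
      finally have "card S * Suc K ^ n \<le> card S * ((Suc M' * Suc M' * C) * K ^ n)" by (simp only: mult_ac)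
      moreover have "card S > 0" using S(2,4) x(1) unfolding spans_def by (metis card_gt_0_iff equals0D imageI)
      ultimately show ?thesis by (simp only: mult_le_cancel1)
    qed
    then show False by (rule pow_growth[OF \<open>K > 0\<close>])
  qed
qed

end

theorem theorem1p1:
  fixes X :: "'a::metric_space set" and f :: "'a \<Rightarrow> 'a"
  assumes "Smale_space X f" and "irreducible_system X f"
  shows "Moore_property X f \<and> Myhill_property X f"
proof -
  interpret irreducible_Smale X f using assms by unfold_locales
  show ?thesis using Moore Myhill by simp
qed

end
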